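(* Let $(\mathcal N,\mathcal O,\mathfrak l)$ be a plabic network representing a point $[A]$ in a positroid cell $\mathcal S_{\mathcal M}^{\mathrm{TNN}}\subset Gr^{\mathrm{TNN}}(k,n)$, with perfect orientation $\mathcal O$ associated to the base $I=\{1\le i_1<\dots<i_k\le n\}$ in the matroid $\mathcal M$ and gauge ray direction $\mathfrak l$. Assign vectors $B_j$ to the boundary sinks $b_j$, $j\in\bar I$. Then for every edge $e$ the edge vector $$E_e=\sum_{j\in\bar I}\Big(\sum_{\mathcal P:e\to b_j}(-1)^{\mathrm{wind}(\mathcal P)+\mathrm{int}(\mathcal P)}w(\mathcal P)\Big)B_j$$ is a rational expression in the weights of the network with subtraction-free denominator: $$E_e=\sum_{j\in\bar I}\left[\frac{\displaystyle\sum_{F\in\mathcal F_{e,b_j}(\mathcal G)}(-1)^{\mathrm{wind}(F)+\mathrm{int}(F)}\,w(F)}{\displaystyle\sum_{C\in\mathcal C(\mathcal G)}w(C)}\right]B_j .$$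
   Context: **Plabic networks.** Let $D$ be a closed convex disk whose boundary contains a straight segment. A plabic graph $\mathcal G$ is a finite directed planar graph embedded in $D$ with straight edges. It has boundary vertices $b_1,\dots,b_n$ on the segment, labelled clockwise, each of degree 1 (a source if its edge is outgoing, a sink otherwise). The remaining (internal) vertices lie inside $D$ and have degree 2 or 3. No component is isolated from the boundary. The graph is perfect: each internal vertex has exactly one incoming edge (then it is white) or exactly one outgoing edge (then it is black); a bivalent vertex has one incoming and one outgoing edge and is given either color. The orientation $\mathcal O$ is called a perfect orientation. $I$ is the set of indices of the boundary sources, $|I|=k$, and $\bar I=[n]\setminus I$. A network $\mathcal N$ is $\mathcal G$ with a positive weight $w_e$ on each edge. $\mathcal M=\mathcal M_{\mathcal G}$ is the set of source sets of all perfect orientations of $\mathcal G$ compatible with the coloring, and $\mathcal S^{\mathrm{TNN}}_{\mathcal M}\subset Gr^{\mathrm{TNN}}(k,n)$ is the set of points whose maximal minors satisfy $\Delta_J>0$ for $J\in\mathcal M$ and $\Delta_J=0$ otherwise. **Gauge rays.** A gauge ray direction $\mathfrak l$ is an oriented direction, not parallel to any edge, such that the rays with direction $\mathfrak l$ starting at boundary vertices point inside $D$ and contain no internal vertices. The gauge rays are the rays $\mathfrak l_{i_r}$ starting at the boundary sources. $\mathrm{int}(e)$ is the number of intersections of the edge $e$ with the gauge rays (the base point of a ray is not counted). **Winding.** For nonzero planar vectors, $s(a,b)=+1,0,-1$ if the ordered pair $(a,b)$ is positively oriented, parallel, negatively oriented respectively. For consecutive directed edges $e,f$: $\mathrm{wind}(e,f)=1$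 if $s(e,f)=s(e,\mathfrak l)=s(\mathfrak l,f)=1$; $\mathrm{wind}(e,f)=-1$ if $s(e,f)=s(e,\mathfrak l)=s(\mathfrak l,f)=-1$; otherwise $0$. **Paths.** For a directed path $\mathcal P=(e_1,\dots,e_m)$ (edges may repeat): $w(\mathcal P)=\prod_l w_{e_l}$, $\mathrm{wind}(\mathcal P)=\sum_{l<m}\mathrm{wind}(e_l,e_{l+1})$, $\mathrm{int}(\mathcal P)=\sum_l\mathrm{int}(e_l)$. Sums over $\mathcal P:e\to b_j$ run over all directed paths with first edge $e$ ending at $b_j$. They are formal power series in the weights (convergent for small weights), and the identity in the claim is an identity of such series. For arbitrary positive weights the rational expression is the meaning of $E_e$. **Flows.** A conservative flow is a collection of distinct edges, none incident to the boundary, with as many edges arriving as leaving at every internal vertex. $\mathcal C(\mathcal G)$ is the set of all of them, including the empty one (weight 1). An edge flow starting at $e$ is a collection $F$ of distinct edges such that: - it contains $e$; - at each internal vertex other than the starting vertex $V$ of $e$ the numbers of arriving and leaving edges of $F$ are equal; - at $V$ the number of arriving edges of $F$ equals the number of leaving edges minus 1; - $F$ contains no edges at boundary sources except possibly $e$. $\mathcal F_{e,b_j}(\mathcal G)$ is the set of edge flows starting at $e$ that contain the boundary sink $b_j$. Each $F\in\mathcal F_{e,b_j}(\mathcal G)$ is the union of an edge loop-erased walk $P$ (a directed path from $e$ to $b_j$ not passing any edge twice) and a (possibly trivial) conservative flow having no common edges with $P$. The weight $w(\cdot)$ of a flow is the product of the weights of its edges; $\mathrm{wind}(F):=\mathrm{wind}(P)$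 and $\mathrm{int}(F):=\mathrm{int}(P)$. *)

theory Defs
  imports
    "HOL-Analysis.Analysis"
    "HOL-Library.Multiset"
    "Graph_Theory.Arc_Walk"
    "Jordan_Normal_Form.DL_Rank"
    "Jordan_Normal_Form.DL_Submatrix"
begin

section \<open>Plabic graphs\<close>

text \<open>The plane is \<^typ>\<open>complex\<close>. The vertices of a graph are points of the plane, and an
  arc \<open>a\<close> is drawn as the segment from its tail to its head. The orientation of
  \<open>graph N\<close> is the given perfect orientation. Boundary vertices are indexed by
  \<open>{..<nb N}\<close>, i.e. \<open>bv N i\<close> is the vertex usually called $b_{i+1}$.\<close>

record 'e plabic =
  graph :: "(complex, 'e) pre_digraph"
  disk :: "complex set"
  nb :: nat
  bv :: "nat \<Rightarrow> complex"
  white :: "complex set"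

definition boundary :: "'e plabic \<Rightarrow> complex set" where
  "boundary N = bv N ` {..<nb N}"

definition internal :: "'e plabic \<Rightarrow> complex set" where
  "internal N = verts (graph N) - boundary N"

definition arc_segment :: "'e plabic \<Rightarrow> 'e \<Rightarrow> complex set" where
  "arc_segment N a = closed_segment (tail (graph N) a) (head (graph N) a)"

definition arc_dir :: "'e plabic \<Rightarrow> 'e \<Rightarrow> complex" where
  "arc_dir N a = head (graph N) a - tail (graph N) a"

text \<open>\<open>orient a b\<close> is the sign of the determinant with columns \<open>a\<close>, \<open>b\<close>.\<close>

definition orient :: "complex \<Rightarrow> complex \<Rightarrow> real" where
  "orient a b = sgn (Im (cnj a * b))"

text \<open>The disk lies to the right of the directed segment from \<open>p\<close> to \<open>q\<close>, so moving from
  \<open>p\<close> to \<open>q\<close> runs clockwise along its frontier.\<close>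

definition marked_disk :: "'e plabic \<Rightarrow> bool" where
  "marked_disk N \<longleftrightarrow>
     compact (disk N) \<and> convex (disk N) \<and> interior (disk N) \<noteq> {} \<and>
     (\<exists>p q. p \<noteq> q \<and> closed_segment p q \<subseteq> frontier (disk N) \<and>
        (\<forall>z\<in>disk N. orient (q - p) (z - p) \<le> 0) \<and>
        (\<forall>i<nb N. bv N i \<in> closed_segment p q) \<and>
        (\<forall>i j. i < j \<and> j < nb N \<longrightarrow> dist p (bv N i) < dist p (bv N j)))"

definition straight_embedding :: "'e plabic \<Rightarrow> bool" where
  "straight_embedding N \<longleftrightarrow>
     digraph (graph N) \<and>
     boundary N \<subseteq> verts (graph N) \<and>
     internal N \<subseteq> interior (disk N) \<and>
     (\<forall>a\<in>arcs (graph N). arc_segment N a \<inter> verts (graph N)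
        = {tail (graph N) a, head (graph N) a}) \<and>
     (\<forall>a\<in>arcs (graph N). \<forall>c\<in>arcs (graph N). a \<noteq> c \<longrightarrow>
        arc_segment N a \<inter> arc_segment N c
        \<subseteq> {tail (graph N) a, head (graph N) a} \<inter> {tail (graph N) c, head (graph N) c})"

definition vdegree :: "'e plabic \<Rightarrow> complex \<Rightarrow> nat" where
  "vdegree N v = in_degree (graph N) v + out_degree (graph N) v"

text \<open>An orientation of the underlying graph is passed as a digraph \<open>H\<close>; a bivalent vertex
  of either colour then has one incoming and one outgoing arc.\<close>

definition perfect :: "'e plabic \<Rightarrow> (complex, 'e) pre_digraph \<Rightarrow> bool" where
  "perfect N H \<longleftrightarrow>
     (\<forall>v\<in>internal N. if v \<in> white N then in_degree H v = 1 else out_degree H v = 1)"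

definition plabic_graph :: "'e plabic \<Rightarrow> bool" where
  "plabic_graph N \<longleftrightarrow>
     marked_disk N \<and> straight_embedding N \<and>
     white N \<subseteq> internal N \<and>
     (\<forall>v\<in>boundary N. vdegree N v = 1) \<and>
     (\<forall>v\<in>internal N. vdegree N v = 2 \<or> vdegree N v = 3) \<and>
     (\<forall>v\<in>verts (graph N). \<exists>u\<in>boundary N.
        (v, u) \<in> (arcs_ends (graph N) \<union> (arcs_ends (graph N))\<inverse>)\<^sup>*) \<and>
     perfect N (graph N)"

definition source_set :: "'e plabic \<Rightarrow> (complex, 'e) pre_digraph \<Rightarrow> nat set" where
  "source_set N H = {i. i < nb N \<and> out_degree H (bv N i) = 1}"

abbreviation sources :: "'e plabic \<Rightarrow> nat set" where
  "sources N \<equiv> source_set N (graph N)"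

definition sinks :: "'e plabic \<Rightarrow> nat set" where
  "sinks N = {..<nb N} - sources N"

definition positive_weights :: "'e plabic \<Rightarrow> ('e \<Rightarrow> real) \<Rightarrow> bool" where
  "positive_weights N w \<longleftrightarrow> (\<forall>a\<in>arcs (graph N). 0 < w a)"


section \<open>Flows\<close>

definition balanced :: "'e plabic \<Rightarrow> 'e set \<Rightarrow> complex \<Rightarrow> bool" where
  "balanced N F v \<longleftrightarrow> card (F \<inter> in_arcs (graph N) v) = card (F \<inter> out_arcs (graph N) v)"

definition conservative_flows :: "'e plabic \<Rightarrow> 'e set set" where
  "conservative_flows N = {C. C \<subseteq> arcs (graph N) \<and>
     (\<forall>a\<in>C. tail (graph N) a \<notin> boundary N \<and> head (graph N) a \<notin> boundary N) \<and>
     (\<forall>v\<in>internal N. balanced N C v)}"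

definition edge_flows :: "'e plabic \<Rightarrow> 'e \<Rightarrow> nat \<Rightarrow> 'e set set" where
  "edge_flows N e j = {F. F \<subseteq> arcs (graph N) \<and> e \<in> F \<and>
     (\<forall>v\<in>internal N - {tail (graph N) e}. balanced N F v) \<and>
     card (F \<inter> in_arcs (graph N) (tail (graph N) e)) + 1
       = card (F \<inter> out_arcs (graph N) (tail (graph N) e)) \<and>
     (\<forall>a\<in>F. \<forall>i\<in>sources N. bv N i \<in> {tail (graph N) a, head (graph N) a} \<longrightarrow> a = e) \<and>
     (\<exists>a\<in>F. head (graph N) a = bv N j)}"

definition paths :: "'e plabic \<Rightarrow> 'e \<Rightarrow> nat \<Rightarrow> 'e list set" where
  "paths N e j = {P. P \<noteq> [] \<and> hd P = e \<and>
     pre_digraph.awalk (graph N) (tail (graph N) e) P (bv N j)}"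

text \<open>The edge loop-erased walk \<open>P\<close> in the decomposition of an edge flow. It is unique: by
  perfectness an edge flow leaves every vertex reached from \<open>e\<close> by at most one arc different
  from \<open>e\<close>.\<close>

definition flow_walk :: "'e plabic \<Rightarrow> 'e \<Rightarrow> nat \<Rightarrow> 'e set \<Rightarrow> 'e list" where
  "flow_walk N e j F = (THE P. P \<in> paths N e j \<and> distinct P \<and> set P \<subseteq> F \<and>
     F - set P \<in> conservative_flows N)"


section \<open>Positroid cells\<close>

definition reorient :: "'e set \<Rightarrow> (complex, 'e) pre_digraph \<Rightarrow> (complex, 'e) pre_digraph" where
  "reorient R H = H\<lparr>tail := (\<lambda>a. if a \<in> R then head H a else tail H a),
                    head := (\<lambda>a. if a \<in> R then tail H a else head H a)\<rparr>"

definition matroid :: "'e plabic \<Rightarrow> nat set set" where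
  "matroid N = {source_set N (reorient R (graph N)) | R.
     R \<subseteq> arcs (graph N) \<and> perfect N (reorient R (graph N))}"

definition minor :: "real mat \<Rightarrow> nat set \<Rightarrow> real" where
  "minor A J = Determinant.det (submatrix A UNIV J)"

text \<open>A point of the Grassmannian is given by a matrix of full rank with that row space; the
  minors of such a matrix are the Pluecker coordinates of the point, up to a common factor.\<close>

definition tnn_cell :: "nat \<Rightarrow> nat \<Rightarrow> nat set set \<Rightarrow> real mat set" where
  "tnn_cell k n M = {A. A \<in> carrier_mat k n \<and> vec_space.rank k A = k \<and>
     (\<forall>J. J \<subseteq> {..<n} \<and> card J = k \<longrightarrow>
        (if J \<in> M then 0 < minor A J else minor A J = 0))}"

text \<open>Flows from the sources \<open>I\<close> to \<open>J\<close>: balanced sets of arcs which use the boundary arcs at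
  \<open>I - J\<close> and \<open>J - I\<close> and no other boundary arcs.\<close>

definition boundary_flows :: "'e plabic \<Rightarrow> nat set \<Rightarrow> 'e set set" where
  "boundary_flows N J = {F. F \<subseteq> arcs (graph N) \<and> (\<forall>v\<in>internal N. balanced N F v) \<and>
     (\<forall>i<nb N. (\<exists>a\<in>F. bv N i \<in> {tail (graph N) a, head (graph N) a}) \<longleftrightarrow>
        i \<in> (sources N - J) \<union> (J - sources N))}"

text \<open>The boundary measurement map in Talaska's form: the Pluecker coordinates of the point
  represented by the network are the flow polynomials, up to a common factor.\<close>

definition represents :: "'e plabic \<Rightarrow> ('e \<Rightarrow> real) \<Rightarrow> real mat \<Rightarrow> bool" where
  "represents N w A \<longleftrightarrow> A \<in> carrier_mat (card (sources N)) (nb N) \<and>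
     (\<exists>c. c \<noteq> 0 \<and> (\<forall>J. J \<subseteq> {..<nb N} \<and> card J = card (sources N) \<longrightarrow>
        minor A J = c * (\<Sum>F\<in>boundary_flows N J. \<Prod>a\<in>F. w a)))"


section \<open>Gauge rays, winding and intersection numbers\<close>

definition gauge_direction :: "'e plabic \<Rightarrow> complex \<Rightarrow> bool" where
  "gauge_direction N l \<longleftrightarrow> l \<noteq> 0 \<and>
     (\<forall>a\<in>arcs (graph N). orient (arc_dir N a) l \<noteq> 0) \<and>
     (\<forall>i<nb N. (\<exists>\<epsilon>>0. \<forall>t. 0 < t \<and> t < \<epsilon> \<longrightarrow> bv N i + t *\<^sub>R l \<in> interior (disk N)) \<and>
        (\<forall>t\<ge>0. bv N i + t *\<^sub>R l \<notin> internal N))"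

definition arc_int :: "'e plabic \<Rightarrow> complex \<Rightarrow> 'e \<Rightarrow> nat" where
  "arc_int N l a = card (arc_segment N a \<inter> {bv N i + t *\<^sub>R l | i t. i \<in> sources N \<and> 0 < t})"

definition turn :: "'e plabic \<Rightarrow> complex \<Rightarrow> 'e \<Rightarrow> 'e \<Rightarrow> int" where
  "turn N l a c =
     (let u = arc_dir N a; v = arc_dir N c in
      if orient u v = 1 \<and> orient u l = 1 \<and> orient l v = 1 then 1
      else if orient u v = -1 \<and> orient u l = -1 \<and> orient l v = -1 then -1
      else 0)"

definition wind :: "'e plabic \<Rightarrow> complex \<Rightarrow> 'e list \<Rightarrow> int" where
  "wind N l P = (\<Sum>i<length P - 1. turn N l (P ! i) (P ! Suc i))"

definition path_int :: "'e plabic \<Rightarrow> complex \<Rightarrow> 'e list \<Rightarrow> nat" where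
  "path_int N l P = (\<Sum>a\<leftarrow>P. arc_int N l a)"

definition path_sign :: "'e plabic \<Rightarrow> complex \<Rightarrow> 'e list \<Rightarrow> real" where
  "path_sign N l P = (-1) powi (wind N l P + int (path_int N l P))"

definition flow_sign :: "'e plabic \<Rightarrow> complex \<Rightarrow> 'e \<Rightarrow> nat \<Rightarrow> 'e set \<Rightarrow> real" where
  "flow_sign N l e j F = path_sign N l (flow_walk N e j F)"


section \<open>Formal power series in the edge weights\<close>

text \<open>A monomial in the weights is a multiset of arcs, and a formal power series is the function
  sending a monomial to its coefficient. \<open>formal_sum X c \<mu>\<close> is $\sum_{x \in X} c(x)\,\mu(x)$;
  it is meaningful when only finitely many members of \<open>X\<close> share any given monomial, as is the
  case for the paths in a finite graph.\<close>

type_synonym 'e series = "'e multiset \<Rightarrow> real"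

definition formal_sum :: "'x set \<Rightarrow> ('x \<Rightarrow> real) \<Rightarrow> ('x \<Rightarrow> 'e multiset) \<Rightarrow> 'e series" where
  "formal_sum X c \<mu> = (\<lambda>m. \<Sum>x | x \<in> X \<and> \<mu> x = m. c x)"

definition series_mult :: "'e series \<Rightarrow> 'e series \<Rightarrow> 'e series" where
  "series_mult f g = (\<lambda>m. \<Sum>m' | m' \<subseteq># m. f m' * g (m - m'))"

text \<open>If the constant term \<open>g {#}\<close> is nonzero, \<open>g\<close> is a unit of the ring of power series and the
  quotient exists and is unique.\<close>

definition series_div :: "'e series \<Rightarrow> 'e series \<Rightarrow> 'e series" where
  "series_div f g = (THE q. series_mult q g = f)"

definition path_series :: "'e plabic \<Rightarrow> complex \<Rightarrow> 'e \<Rightarrow> nat \<Rightarrow> 'e series" where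
  "path_series N l e j = formal_sum (paths N e j) (path_sign N l) mset"

definition flow_series :: "'e plabic \<Rightarrow> complex \<Rightarrow> 'e \<Rightarrow> nat \<Rightarrow> 'e series" where
  "flow_series N l e j = formal_sum (edge_flows N e j) (flow_sign N l e j) mset_set"

definition conservative_series :: "'e plabic \<Rightarrow> 'e series" where
  "conservative_series N = formal_sum (conservative_flows N) (\<lambda>_. 1) mset_set"

text \<open>\<open>vector_series J f B\<close> is $\sum_{j \in J} f_j B_j$, a power series with vector
  coefficients.\<close>

definition vector_series ::
    "nat set \<Rightarrow> (nat \<Rightarrow> 'e series) \<Rightarrow> (nat \<Rightarrow> 'v::real_vector) \<Rightarrow> 'e multiset \<Rightarrow> 'v" where
  "vector_series J f B = (\<lambda>m. \<Sum>j\<in>J. f j m *\<^sub>R B j)"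

definition edge_vector ::
    "'e plabic \<Rightarrow> complex \<Rightarrow> (nat \<Rightarrow> 'v::real_vector) \<Rightarrow> 'e \<Rightarrow> 'e multiset \<Rightarrow> 'v" where
  "edge_vector N l B e = vector_series (sinks N) (path_series N l e) B"

end

(* Both sides of the claim, multiplied by the conservative flow polynomial, are power series whose
   coefficients satisfy the same recursion, obtained by splitting off the first arc e.

   For the walks this is clear. A flow F starting at e that reaches an internal vertex v = head e
   leaves v by a unique arc f, and F - {e} is a flow starting at f. Conversely, prepending e to a
   flow starting at f gives a flow starting at e unless the flow already contains e. In this case
   it contains both arcs f, g leaving v, so it counts as a flow from f and as a flow from g, and
   these contributions have to cancel. One of the two loop-erased walks is a simple closed walk
   through e followed by the other, so the contributions cancel if (-1)^(wind + int) = -1 for every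
   simple closed walk. This is a topological fact about a simple polygon: its winding is odd, by
   Hopf's Umlaufsatz modulo 2, and a ray starting outside of it crosses it an even number of
   times. *)

theory Submission
  imports Defs
begin

no_notation scalar_prod (infix "\<bullet>" 70)

section \<open>The winding of a simple polygon modulo 2\<close>

text \<open>Loop erasure only keeps a walk from repeating arcs. Perfectness does the rest: an
  internal vertex has one incoming or one outgoing arc, so a closed walk with distinct arcs through
  internal vertices visits no vertex twice and traces a simple polygon. The same fact shows that a
  flow which contains e and starts at v = head e has e as its only arc into v and exactly two arcs
  out of v. Only parities matter, so angles are replaced by signs. Passing the direction
  \<open>l\<close> is a sign attached to a pair of vectors, and on an open half-plane this sign is a
  coboundary; Hopf's deformation of tangents into chords then becomes a finite product over cells.
  For the rays, the crossing parity of an arc is the product of a sign at its two ends, and these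
  signs cancel around a closed walk. The recursion determines all coefficients because every
  monomial that occurs for e contains e, so splitting off e lowers the degree. The quotient exists
  because the empty flow gives the denominator the constant term 1.\<close>

definition cross :: "complex \<Rightarrow> complex \<Rightarrow> real" where
  "cross a b = Im (cnj a * b)"

lemma cross_minus [simp]: "cross (- a) b = - cross a b" "cross a (- b) = - cross a b"
  by (simp_all add: cross_def)

lemma cross_swap: "cross b a = - cross a b"
  by (simp add: cross_def)

text \<open>\<open>upper l\<close> is one side of the line spanned by \<open>l\<close>. Vectors on this line are assigned to the
  sides as if \<open>l\<close> were rotated slightly, since chords of a polygon may be parallel to \<open>l\<close>.
  \<open>crossing l a b\<close> is \<open>-1\<close> iff the shorter rotation from \<open>a\<close> to \<open>b\<close> passes the direction \<open>l\<close>.\<close>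

definition upper :: "complex \<Rightarrow> complex \<Rightarrow> bool" where
  "upper l a \<longleftrightarrow> 0 < cross a l \<or> cross a l = 0 \<and> 0 < a \<bullet> l"

definition crossing :: "complex \<Rightarrow> complex \<Rightarrow> complex \<Rightarrow> real" where
  "crossing l a b =
     (if upper l a \<noteq> upper l b \<and> (upper l a \<longleftrightarrow> 0 < cross a b) then - 1 else 1)"

text \<open>By Lagrange's identity \<open>cross a l\<close> and \<open>a \<bullet> l\<close> cannot
  both vanish for nonzero vectors, so the tie-break on the line of \<open>l\<close> always
  decides.\<close>

lemma upper_minus:
  assumes "l \<noteq> 0" "a \<noteq> 0"
  shows "upper l (- a) \<longleftrightarrow> \<not> upper l a"
proof -
  have "(cross a l)\<^sup>2 + (a \<bullet> l)\<^sup>2 = (a \<bullet> a) * (l \<bullet> l)"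
    by (simp add: cross_def inner_complex_def power2_eq_square algebra_simps)
  moreover have "0 < (a \<bullet> a) * (l \<bullet> l)"
    using assms by simp
  ultimately have "cross a l \<noteq> 0 \<or> a \<bullet> l \<noteq> 0" by auto
  then show ?thesis by (auto simp: upper_def)
qed

text \<open>Inside the half-plane given by \<open>u\<close>, changing sides means passing either
  \<open>l\<close> or \<open>- l\<close>, and the sign of \<open>u \<bullet> l\<close> tells which.
  The proof rests on the identity \<open>cross a b * (u \<bullet> l) = cross a l * (u \<bullet> b) -
  cross b l * (u \<bullet> a)\<close>, where both contributions on the right are
  nonnegative.\<close>

lemma sgn_cross_half_plane:
  assumes "l \<noteq> 0" "0 < u \<bullet> a" "0 < u \<bullet> b" "upper l a" "\<not> upper l b"
  shows "0 < cross a b * (u \<bullet> l)"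
proof -
  have *: "(z \<bullet> l) * (u \<bullet> l) = (l \<bullet> l) * (u \<bullet> z)" if "cross z l = 0" for z
  proof -
    have "(z \<bullet> l) * (u \<bullet> l) = (l \<bullet> l) * (u \<bullet> z) - cross z l * cross u l"
      by (simp add: cross_def inner_complex_def algebra_simps)
    with that show ?thesis by simp
  qed
  have ll: "0 < l \<bullet> l" using assms(1) by simp
  \<comment> \<open>If both vectors were parallel to \<open>l\<close>, the half-plane would make
    them point the same way, and the tie-break would put them on the same side.\<close>
  have "cross a l \<noteq> 0 \<or> cross b l \<noteq> 0"
  proof (rule ccontr)
    assume "\<not> ?thesis"
    then have z: "cross a l = 0" "cross b l = 0" by auto
    have "0 < (a \<bullet> l) * (u \<bullet> l)" "0 < (b \<bullet> l) * (u \<bullet> l)"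
      using *[OF z(1)] *[OF z(2)] ll assms by simp_all
    moreover have "0 < a \<bullet> l" "b \<bullet> l \<le> 0"
      using assms(4,5) z by (auto simp: upper_def)
    ultimately show False by (simp add: zero_less_mult_iff)
  qed
  moreover have "0 \<le> cross a l" "cross b l \<le> 0"
    using assms(4,5) by (auto simp: upper_def)
  ultimately consider "0 < cross a l" "cross b l \<le> 0" | "0 \<le> cross a l" "cross b l < 0"
    by linarith
  then have "0 < cross a l * (u \<bullet> b) + - cross b l * (u \<bullet> a)"
  proof cases
    case 1
    then have "0 < cross a l * (u \<bullet> b)" "0 \<le> - cross b l * (u \<bullet> a)"
      using assms(2,3) by (simp_all add: mult_nonpos_nonneg)
    then show ?thesis by linarith
  next
    case 2
    then have "0 \<le> cross a l * (u \<bullet> b)" "0 < - cross b l * (u \<bullet> a)"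
      using assms(2,3) by (simp_all add: mult_neg_pos)
    then show ?thesis by linarith
  qed
  moreover have "cross a b * (u \<bullet> l) = cross a l * (u \<bullet> b) + - cross b l * (u \<bullet> a)"
    by (simp add: cross_def inner_complex_def algebra_simps)
  ultimately show ?thesis by simp
qed

text \<open>On an open half-plane crossing the ray of \<open>l\<close> is a coboundary.\<close>

lemma crossing_half_plane:
  assumes "l \<noteq> 0" "0 < u \<bullet> a" "0 < u \<bullet> b"
  shows "crossing l a b
    = (if 0 < u \<bullet> l \<and> upper l a then - 1 else 1) * (if 0 < u \<bullet> l \<and> upper l b then - 1 else 1)"
proof -
  consider "upper l a = upper l b" | "upper l a" "\<not> upper l b" | "\<not> upper l a" "upper l b"
    by blast
  then show ?thesis
  proof cases
    case 1 then show ?thesis by (simp add: crossing_def)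
  next
    case 2
    have "0 < cross a b * (u \<bullet> l)" using sgn_cross_half_plane[OF assms] 2 by blast
    then show ?thesis using 2 by (auto simp: crossing_def zero_less_mult_iff)
  next
    case 3
    have "0 < cross b a * (u \<bullet> l)" using sgn_cross_half_plane[OF assms(1,3,2)] 3 by blast
    then have "cross a b * (u \<bullet> l) < 0" by (simp add: cross_swap[of b a])
    then show ?thesis using 3 by (auto simp: crossing_def mult_less_0_iff)
  qed
qed

lemma half_plane_of_segment:
  fixes a b :: complex
  assumes "0 \<notin> closed_segment a b"
  obtains u where "0 < u \<bullet> a" "0 < u \<bullet> b"
proof -
  obtain u c where "0 < c" "\<forall>x\<in>closed_segment a b. u \<bullet> x > c"
    using separating_hyperplane_closed_0[OF convex_closed_segment closed_segment assms] by blast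
  then have "0 < u \<bullet> a" "0 < u \<bullet> b"
    by (meson ends_in_segment less_trans)+
  then show ?thesis by (rule that)
qed

text \<open>The vectors \<open>a\<close>, \<open>b\<close> and \<open>a + b\<close> share an open
  half-plane, where the contributions of the middle vector cancel.\<close>

lemma crossing_add:
  assumes "l \<noteq> 0" "0 \<notin> closed_segment a b"
  shows "crossing l a b = crossing l a (a + b) * crossing l (a + b) b"
proof -
  obtain u where u: "0 < u \<bullet> a" "0 < u \<bullet> b" by (rule half_plane_of_segment[OF assms(2)])
  then have s: "0 < u \<bullet> (a + b)" by (simp add: inner_add_right)
  show ?thesis
    by (simp add: crossing_half_plane[OF assms(1) u] crossing_half_plane[OF assms(1) u(1) s]
        crossing_half_plane[OF assms(1) s u(2)])
qed

text \<open>A line separating the two segments puts all four chords between them into one open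
  half-plane, where a product of crossings depends only on the first and last vector.\<close>

lemma crossing_cell:
  assumes "l \<noteq> 0" "closed_segment x x' \<inter> closed_segment y y' = {}"
  shows "crossing l (y - x) (y - x') * crossing l (y - x') (y' - x')
    = crossing l (y - x) (y' - x) * crossing l (y' - x) (y' - x')"
proof -
  obtain u c where "\<forall>z\<in>closed_segment x x'. u \<bullet> z < c" "\<forall>z\<in>closed_segment y y'. u \<bullet> z > c"
    using separating_hyperplane_compact_closed[OF convex_closed_segment compact_segment _
        convex_closed_segment closed_segment assms(2)] by auto
  then have "u \<bullet> x < c" "u \<bullet> x' < c" "c < u \<bullet> y" "c < u \<bullet> y'" by auto
  then have "0 < u \<bullet> (y - x)" "0 < u \<bullet> (y - x')" "0 < u \<bullet> (y' - x)" "0 < u \<bullet> (y' - x')"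
    by (simp_all add: inner_diff_right)
  then show ?thesis by (simp add: crossing_half_plane[OF assms(1)])
qed

section \<open>Products of crossings over the chords of a polygon\<close>

lemma crossing_same: "upper l a = upper l b \<Longrightarrow> crossing l a b = 1"
  by (simp add: crossing_def)

text \<open>The pairs i < j, each carrying the chord \<open>v j - v i\<close>, form the triangle of
  Hopf's proof. The two sides of the equation are two routes from (i, i+1) to (i+1, m). They enclose
  one triangle, trivial by \<open>crossing_add\<close>, and a strip of unit squares, trivial by
  \<open>crossing_cell\<close>.\<close>

lemma polygon_row:
  fixes v :: "nat \<Rightarrow> complex" and l :: complex
  defines "K \<equiv> \<lambda>i j i' j'. crossing l (v j - v i) (v j' - v i')"
  assumes "l \<noteq> 0" "0 \<notin> closed_segment (v (Suc i) - v i) (v (Suc (Suc i)) - v (Suc i))"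
    and "Suc (Suc i) \<le> m"
    and "\<And>j. Suc i < j \<Longrightarrow> j < m \<Longrightarrow>
      closed_segment (v i) (v (Suc i)) \<inter> closed_segment (v j) (v (Suc j)) = {}"
  shows "K i (Suc i) (Suc i) (Suc (Suc i)) * (\<Prod>j\<in>{Suc (Suc i)..<m}. K (Suc i) j (Suc i) (Suc j))
    = (\<Prod>j\<in>{Suc i..<m}. K i j i (Suc j)) * K i m (Suc i) m"
  using assms(4,5)
proof (induction m rule: dec_induct)
  case base
  show ?case
    using crossing_add[OF assms(2,3)] by (simp add: K_def)
next
  case (step m)
  have cell: "K i m (Suc i) m * K (Suc i) m (Suc i) (Suc m) = K i m i (Suc m) * K i (Suc m) (Suc i) (Suc m)"
    unfolding K_def using step by (intro crossing_cell assms) auto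
  have "K i (Suc i) (Suc i) (Suc (Suc i))
      * (\<Prod>j\<in>{Suc (Suc i)..<Suc m}. K (Suc i) j (Suc i) (Suc j))
    = (\<Prod>j\<in>{Suc i..<m}. K i j i (Suc j)) * (K i m (Suc i) m * K (Suc i) m (Suc i) (Suc m))"
    using step by simp
  also have "\<dots> = (\<Prod>j\<in>{Suc i..<Suc m}. K i j i (Suc j)) * K i (Suc m) (Suc i) (Suc m)"
    using step(1) by (simp add: cell)
  finally show ?case .
qed

text \<open>Hopf's Umlaufsatz modulo 2. The chords \<open>v j - v i\<close> deform the product over consecutive
  sides into a product over the chords from and to \<open>v 0\<close>, where only one crossing occurs because
  the polygon lies on one side of \<open>v 0\<close>.\<close>

lemma umlaufsatz_extremal:
  fixes v :: "nat \<Rightarrow> complex"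
  assumes l: "l \<noteq> 0" and n: "3 \<le> n" and per: "v n = v 0" "v (Suc n) = v 1"
    and adj: "\<And>i. 0 \<notin> closed_segment (v (Suc i) - v i) (v (Suc (Suc i)) - v (Suc i))"
    and dis: "\<And>i j. Suc i < j \<Longrightarrow> Suc j < i + n \<Longrightarrow>
      closed_segment (v i) (v (Suc i)) \<inter> closed_segment (v j) (v (Suc j)) = {}"
    and ne: "\<And>j. 0 < j \<Longrightarrow> j < n \<Longrightarrow> v j \<noteq> v 0"
    and up: "\<And>j. 0 < j \<Longrightarrow> j < n \<Longrightarrow> upper l (v j - v 0)"
  shows "(\<Prod>i<n. crossing l (v (Suc i) - v i) (v (Suc (Suc i)) - v (Suc i))) = - 1"
proof -
  define K where "K i j i' j' = crossing l (v j - v i) (v j' - v i')" for i j i' j'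
  define D where "D i = K i (Suc i) (Suc i) (Suc (Suc i))" for i
  define R where "R i m = (\<Prod>j\<in>{Suc i..<m}. K i j i (Suc j))" for i m
  obtain p where p: "n = Suc (Suc p)" "1 \<le> p" using n
    by (metis Suc_le_D Suc_le_mono numeral_3_eq_3 One_nat_def)
  \<comment> \<open>The bound \<open>m < i + n\<close> keeps the zero chord from \<open>v 0\<close>
    to \<open>v n\<close> out of the grid. Row 0 therefore stops at n - 1, and the corner next to
    (0, n) needs its own argument.\<close>
  have row: "D i * R (Suc i) m = R i m * K i m (Suc i) m"
    if "Suc (Suc i) \<le> m" "m \<le> n" "m < i + n" for i m
    unfolding D_def R_def K_def using that by (intro polygon_row l adj dis) auto
  have down: "\<not> upper l (v 0 - v j)" if "0 < j" "j < n" for j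
    using upper_minus[OF l, of "v j - v 0"] up[OF that] ne[OF that] by simp
  have R0: "R 0 (Suc p) = 1"
    unfolding R_def K_def using p by (intro prod.neutral ballI crossing_same) (simp add: up)
  have row0: "D 0 * R 1 (Suc p) = K 0 (Suc p) 1 (Suc p)"
    using row[of 0 "Suc p"] p R0 by simp
  have "D 0 * R 1 n = K 0 (Suc p) 1 (Suc p) * K 1 (Suc p) 1 n"
  proof -
    have "R 1 n = R 1 (Suc p) * K 1 (Suc p) 1 n" using p by (simp add: R_def)
    with row0 show ?thesis by (metis mult.assoc)
  qed
  also have "\<dots> = K 0 (Suc p) 1 n"
  proof -
    \<comment> \<open>At the corner the two chords are reversed sides adjacent at
      \<open>v 0\<close>, so the condition on consecutive sides again gives a common
      half-plane.\<close>
    have e: "v (Suc p) - v 0 = - (v (Suc (Suc p)) - v (Suc p))"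
      "v n - v 1 = - (v (Suc (Suc (Suc p))) - v (Suc (Suc p)))" using per p by auto
    have "0 \<notin> closed_segment (v (Suc p) - v 0) (v n - v 1)"
    proof
      assume "0 \<in> closed_segment (v (Suc p) - v 0) (v n - v 1)"
      then obtain t where "0 \<le> t" "t \<le> 1"
        "0 = (1 - t) *\<^sub>R (v (Suc p) - v 0) + t *\<^sub>R (v n - v 1)"
        by (auto simp: in_segment)
      then have "0 = (1 - t) *\<^sub>R (v (Suc (Suc p)) - v (Suc p))
          + t *\<^sub>R (v (Suc (Suc (Suc p))) - v (Suc (Suc p)))"
        unfolding e scaleR_minus_right
        by (metis add.inverse_neutral minus_add_distrib minus_equation_iff)
      with \<open>0 \<le> t\<close> \<open>t \<le> 1\<close> adj[of "Suc p"] show False by (auto simp: in_segment)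
    qed
    moreover have "v (Suc p) - v 0 + (v n - v 1) = v (Suc p) - v 1" using per by simp
    ultimately show ?thesis
      using crossing_add[OF l, of "v (Suc p) - v 0" "v n - v 1"] by (simp add: K_def)
  qed
  finally have first: "D 0 * R 1 n = K 0 (Suc p) 1 n" .
  have "(\<Prod>i\<in>{1..<k}. D i) * R k n = R 1 n" if "1 \<le> k" "k \<le> Suc p" for k
    using that
  proof (induction k rule: dec_induct)
    case base
    show ?case by simp
  next
    case (step k)
    have "K k n (Suc k) n = 1"
      unfolding K_def per(1) using step down p by (intro crossing_same) simp
    then have "D k * R (Suc k) n = R k n" using row[of k n] step p by simp
    then have "(\<Prod>i\<in>{1..<k}. D i) * (D k * R (Suc k) n) = R 1 n" using step by simp
    then show ?case using step(1) by (simp add: mult.assoc)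
  qed
  from this[of "Suc p"] have "(\<Prod>i\<in>{1..<Suc p}. D i) = R 1 n"
    using p by (simp add: R_def)
  then have most: "(\<Prod>i<Suc p. D i) = K 0 (Suc p) 1 n"
    using first by (simp add: prod.atLeast_Suc_lessThan lessThan_atLeast0 del: prod.op_ivl_Suc)
  have a: "v (Suc p) \<noteq> v 0" "upper l (v (Suc p) - v 0)" "upper l (v 1 - v 0)"
    "\<not> upper l (v 0 - v 1)" "\<not> upper l (v 0 - v (Suc p))"
    using ne up down p by auto
  \<comment> \<open>The surviving chord rotation and the last turn, at \<open>v 0\<close>, are
    antipodal: equal \<open>cross\<close>, opposite sides. Exactly one of them passes
    \<open>l\<close>, which is the source of the sign.\<close>
  have "cross (v (Suc p) - v 0) (v 0 - v 1) = cross (v 0 - v (Suc p)) (v 1 - v 0)"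
    by (metis cross_minus minus_diff_eq)
  then have "K 0 (Suc p) 1 n * D (Suc p) = - 1"
    unfolding K_def D_def using a p per by (auto simp: crossing_def)
  then have "(\<Prod>i<n. D i) = - 1" using most p by simp
  then show ?thesis by (simp add: D_def K_def)
qed

lemma prod_periodic_shift:
  fixes f :: "nat \<Rightarrow> 'a::comm_monoid_mult"
  assumes "\<And>i. f (i + n) = f i"
  shows "(\<Prod>i<n. f (i + k)) = (\<Prod>i<n. f i)"
proof (induction k)
  case (Suc k)
  show ?case
  proof (cases n)
    case (Suc p)
    have "(\<Prod>i<n. f (i + Suc k)) = (\<Prod>i<p. f (Suc i + k)) * f (n + k)"
      using Suc by simp
    also have "f (n + k) = f (0 + k)" using assms[of k] by (simp add: add.commute)
    also have "(\<Prod>i<p. f (Suc i + k)) * f (0 + k) = (\<Prod>i<n. f (i + k))"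
      unfolding Suc prod.lessThan_Suc_shift by (simp add: mult.commute)
    finally show ?thesis using Suc.IH by simp
  qed simp
qed simp

text \<open>The witness is a lexicographic minimum, first of \<open>cross x l\<close> and then of
  \<open>x \<bullet> l\<close>; \<open>upper l\<close> consists of the positive vectors of this
  order.\<close>

lemma ex_extremal:
  assumes "l \<noteq> 0" "finite X" "X \<noteq> {}"
  obtains x where "x \<in> X" "\<And>y. y \<in> X \<Longrightarrow> y \<noteq> x \<Longrightarrow> upper l (y - x)"
proof -
  define Y where "Y = {x\<in>X. \<forall>y\<in>X. cross x l \<le> cross y l}"
  have Y: "finite Y" "Y \<noteq> {}"
    using assms(2) ex_min_if_finite[of "(\<lambda>x. cross x l) ` X"] assms(3)
    by (auto simp: Y_def not_less)
  obtain x where x: "x \<in> Y" "\<forall>y\<in>Y. x \<bullet> l \<le> y \<bullet> l"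
    using ex_min_if_finite[of "(\<lambda>x. x \<bullet> l) ` Y"] Y by (auto simp: not_less)
  have lin: "cross (a - b) l = cross a l - cross b l" for a b
    by (simp add: cross_def algebra_simps)
  show ?thesis
  proof (rule that)
    show "x \<in> X" using x by (simp add: Y_def)
  next
    fix y assume y: "y \<in> X" "y \<noteq> x"
    have le: "cross x l \<le> cross y l" using x y by (simp add: Y_def)
    show "upper l (y - x)"
    proof (rule ccontr)
      assume n: "\<not> upper l (y - x)"
      then have eq: "cross y l = cross x l" using le by (auto simp: upper_def lin)
      then have "y \<in> Y" using y x by (simp add: Y_def)
      then have "\<not> upper l (- (y - x))" using x eq by (auto simp: upper_def lin inner_diff_left)
      with upper_minus[OF assms(1), of "y - x"] n y show False by simp
    qed
  qed
qed

theorem umlaufsatz_mod_2: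
  fixes v :: "nat \<Rightarrow> complex"
  assumes l: "l \<noteq> 0" and n: "3 \<le> n" and per: "\<And>i. v (i + n) = v i"
    and adj: "\<And>i. 0 \<notin> closed_segment (v (Suc i) - v i) (v (Suc (Suc i)) - v (Suc i))"
    and dis: "\<And>i j. Suc i < j \<Longrightarrow> Suc j < i + n \<Longrightarrow>
      closed_segment (v i) (v (Suc i)) \<inter> closed_segment (v j) (v (Suc j)) = {}"
    and ne: "\<And>i j. i < j \<Longrightarrow> j < i + n \<Longrightarrow> v j \<noteq> v i"
  shows "(\<Prod>i<n. crossing l (v (Suc i) - v i) (v (Suc (Suc i)) - v (Suc i))) = - 1"
proof -
  obtain x where x: "x \<in> v ` {..<n}" "\<And>y. y \<in> v ` {..<n} \<Longrightarrow> y \<noteq> x \<Longrightarrow> upper l (y - x)"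
    using ex_extremal[OF l, of "v ` {..<n}"] n
    by (metis finite_imageI finite_lessThan image_is_empty lessThan_empty_iff not_numeral_le_zero)
  then obtain k where k: "k < n" "x = v k" by auto
  have im: "v j \<in> v ` {..<n}" for j
  proof -
    have "v (j mod n + i * n) = v (j mod n)" for i
    proof (induction i)
      case (Suc i)
      then show ?case using per[of "j mod n + i * n"] by (simp add: algebra_simps)
    qed simp
    from this[of "j div n"] have "v j = v (j mod n)" by simp
    then show ?thesis using n by auto
  qed
  define f where "f i = crossing l (v (Suc i) - v i) (v (Suc (Suc i)) - v (Suc i))" for i
  have "f (i + n) = f i" for i
    using per[of i] per[of "Suc i"] per[of "Suc (Suc i)"] by (simp add: f_def)
  \<comment> \<open>Renumbering by \<open>k\<close> moves the extremal vertex to index 0.\<close>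
  then have "(\<Prod>i<n. f i) = (\<Prod>i<n. f (i + k))" by (simp add: prod_periodic_shift)
  also have "\<dots> = - 1"
    unfolding f_def add_Suc[symmetric]
  proof (rule umlaufsatz_extremal[OF l n, of "\<lambda>i. v (i + k)"])
    show "v (n + k) = v (0 + k)" "v (Suc n + k) = v (1 + k)"
      using per[of k] per[of "Suc k"] by (simp_all add: add.commute)
    show "upper l (v (j + k) - v (0 + k))" if "0 < j" "j < n" for j
      using x(2)[OF im] ne[of k "j + k"] that k by auto
  qed (use adj dis ne in auto)
  finally show ?thesis by (simp add: f_def)
qed

section \<open>Signs of closed walks\<close>

locale plabic_net =
  fixes N :: "'e plabic" and l :: complex
  assumes plabic: "plabic_graph N" and gauge: "gauge_direction N l"
begin

abbreviation src :: "'e \<Rightarrow> complex" where "src \<equiv> tail (graph N)"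
abbreviation tgt :: "'e \<Rightarrow> complex" where "tgt \<equiv> head (graph N)"

sublocale G: digraph "graph N"
  using plabic by (simp add: plabic_graph_def straight_embedding_def)

lemma gauge_nonzero: "l \<noteq> 0"
  using gauge by (simp add: gauge_direction_def)

lemma arc_dir_nonzero: "a \<in> arcs (graph N) \<Longrightarrow> arc_dir N a \<noteq> 0"
  using G.no_loops by (fastforce simp: arc_dir_def)

lemma arc_dir_cross: "a \<in> arcs (graph N) \<Longrightarrow> cross (arc_dir N a) l \<noteq> 0"
  using gauge by (auto simp: gauge_direction_def orient_def cross_def)

lemma arc_segments_meet:
  assumes "a \<in> arcs (graph N)" "c \<in> arcs (graph N)" "a \<noteq> c"
  shows "arc_segment N a \<inter> arc_segment N c \<subseteq> {src a, tgt a} \<inter> {src c, tgt c}"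
  using plabic assms by (simp add: plabic_graph_def straight_embedding_def)

lemma internal_interior: "x \<in> internal N \<Longrightarrow> x \<in> interior (disk N)"
  using plabic by (auto simp: plabic_graph_def straight_embedding_def)

text \<open>Perfectness with the colour forgotten: white vertices give the first alternative, black
  ones the second.\<close>

lemma in_or_out_unique:
  assumes "a \<in> arcs (graph N)" "a' \<in> arcs (graph N)" "b \<in> arcs (graph N)" "b' \<in> arcs (graph N)"
    and "tgt a = v" "tgt a' = v" "src b = v" "src b' = v" "v \<in> internal N"
  shows "a = a' \<or> b = b'"
proof -
  have "card (in_arcs (graph N) v) = 1 \<or> card (out_arcs (graph N) v) = 1"
    using plabic assms(9)
    by (auto simp: plabic_graph_def perfect_def in_degree_def out_degree_def split: if_splits)
  moreover have "a \<in> in_arcs (graph N) v" "a' \<in> in_arcs (graph N) v"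
    "b \<in> out_arcs (graph N) v" "b' \<in> out_arcs (graph N) v"
    using assms(1-8) by simp_all
  ultimately show ?thesis
    by (elim disjE card_1_singletonE) simp_all
qed

section \<open>The boundary segment and the gauge rays\<close>

lemma marked_segment:
  obtains p q where "p \<noteq> q" "\<forall>z\<in>disk N. orient (q - p) (z - p) \<le> 0"
    "\<forall>i<nb N. bv N i \<in> closed_segment p q"
    "\<forall>i j. i < j \<and> j < nb N \<longrightarrow> dist p (bv N i) < dist p (bv N j)"
proof -
  have "marked_disk N" using plabic by (simp add: plabic_graph_def)
  then show ?thesis
    unfolding marked_disk_def by (elim conjE exE) (rule that)
qed

lemma bv_inj:
  assumes "i < nb N" "j < nb N" "bv N i = bv N j"
  shows "i = j"
proof -
  obtain p where "\<forall>i j. i < j \<and> j < nb N \<longrightarrow> dist p (bv N i) < dist p (bv N j)"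
    by (rule marked_segment)
  from this[THEN spec, THEN spec, of i j] this[THEN spec, THEN spec, of j i] show ?thesis
    using assms by (cases i j rule: linorder_cases) auto
qed

lemma cross_diff_right: "cross m (x - y) = cross m x - cross m y"
  by (simp add: cross_def algebra_simps)

text \<open>Here \<open>m\<close> is the direction of the marked segment. Points of the disk satisfy
  the side condition weakly, and interior points strictly because a ball around them fits into the
  disk. The sign of \<open>cross m l\<close> comes from a ray entering the interior, which
  presupposes a boundary vertex.\<close>

lemma boundary_side:
  obtains m where "\<forall>z\<in>interior (disk N). \<forall>i<nb N. cross m (z - bv N i) < 0"
    and "0 < nb N \<longrightarrow> cross m l < 0"
    and "\<forall>i<nb N. \<forall>j<nb N. cross m (bv N i - bv N j) = 0"
proof -
  obtain p q where pq: "p \<noteq> q" "\<forall>z\<in>disk N. orient (q - p) (z - p) \<le> 0"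
    "\<forall>i<nb N. bv N i \<in> closed_segment p q"
    by (rule marked_segment)
  define m where "m = q - p"
  have le: "cross m (z - p) \<le> 0" if "z \<in> disk N" for z
    using pq(2) that by (simp add: m_def orient_def cross_def)
  have lt: "cross m (z - p) < 0" if z: "z \<in> interior (disk N)" for z
  proof -
    obtain r where r: "0 < r" "ball z r \<subseteq> disk N" using z mem_interior by blast
    \<comment> \<open>The vector \<open>\<i> * m\<close> is normal to the segment and points away
      from the disk; the displacement by \<open>t\<close> has length \<open>r / 2\<close>, so it
      stays in the ball.\<close>
    define t where "t = r / 2 / cmod m"
    have m: "cmod m > 0" using pq(1) by (simp add: m_def)
    have "dist z (z + t *\<^sub>R (\<i> * m)) < r"
      using r m by (simp add: t_def dist_norm norm_mult)
    then have "cross m (z + t *\<^sub>R (\<i> * m) - p) \<le> 0" by (intro le subsetD[OF r(2)]) simp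
    moreover have "cross m (z + t *\<^sub>R (\<i> * m) - p) = cross m (z - p) + t * (cmod m)\<^sup>2"
    proof -
      have "cross m (\<i> * m) = (cmod m)\<^sup>2"
        unfolding cmod_power2 by (simp add: cross_def power2_eq_square)
      moreover have "cross m (z + t *\<^sub>R w - p) = cross m (z - p) + t * cross m w" for w
        by (simp add: cross_def algebra_simps)
      ultimately show ?thesis by simp
    qed
    moreover have "0 < t * (cmod m)\<^sup>2" using r m by (simp add: t_def)
    ultimately show ?thesis by linarith
  qed
  have bv0: "cross m (bv N i - p) = 0" if i: "i < nb N" for i
  proof -
    obtain s where "bv N i = (1 - s) *\<^sub>R p + s *\<^sub>R q" using pq(3) i by (auto simp: in_segment)
    then have "bv N i - p = s *\<^sub>R m" by (simp add: m_def algebra_simps)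
    then show ?thesis by (simp add: cross_def)
  qed
  show ?thesis
  proof (rule that[of m])
    have "cross m (z - bv N i) < 0" if "z \<in> interior (disk N)" "i < nb N" for z i
      using lt[OF that(1)] bv0[OF that(2)] by (simp add: cross_diff_right)
    then show "\<forall>z\<in>interior (disk N). \<forall>i<nb N. cross m (z - bv N i) < 0" by blast
    have "cross m (bv N i - bv N j) = 0" if "i < nb N" "j < nb N" for i j
      using bv0[OF that(1)] bv0[OF that(2)] by (simp add: cross_diff_right)
    then show "\<forall>i<nb N. \<forall>j<nb N. cross m (bv N i - bv N j) = 0" by blast
    show "0 < nb N \<longrightarrow> cross m l < 0"
    proof
      assume n: "0 < nb N"
      then have "\<exists>e>0. \<forall>t. 0 < t \<and> t < e \<longrightarrow> bv N 0 + t *\<^sub>R l \<in> interior (disk N)"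
        using gauge by (simp only: gauge_direction_def)
      then obtain e where "0 < e" "\<forall>t. 0 < t \<and> t < e \<longrightarrow> bv N 0 + t *\<^sub>R l \<in> interior (disk N)"
        by (elim exE conjE)
      then have e: "0 < e" "bv N 0 + (e/2) *\<^sub>R l \<in> interior (disk N)" by auto
      have "cross m (bv N 0 + (e/2) *\<^sub>R l - p) = cross m (bv N 0 - p) + (e/2) * cross m l"
        by (simp add: cross_def algebra_simps)
      then have "(e/2) * cross m l < 0" using lt[OF e(2)] bv0[OF n] by simp
      then show "cross m l < 0" using e(1) by (simp add: mult_less_0_iff)
    qed
  qed
qed

lemma cross_zero_parallel:
  assumes "cross w l = 0"
  obtains t where "w = t *\<^sub>R l"
proof (rule that[of "(w \<bullet> l) / (l \<bullet> l)"])
  have "l \<bullet> l \<noteq> 0" using gauge_nonzero by simp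
  moreover have "Re w * (l \<bullet> l) = (w \<bullet> l) * Re l" "Im w * (l \<bullet> l) = (w \<bullet> l) * Im l"
  proof -
    have "Re w * (l \<bullet> l) = (w \<bullet> l) * Re l + cross w l * Im l"
      "Im w * (l \<bullet> l) = (w \<bullet> l) * Im l - cross w l * Re l"
      by (simp_all add: cross_def inner_complex_def algebra_simps)
    then show "Re w * (l \<bullet> l) = (w \<bullet> l) * Re l" "Im w * (l \<bullet> l) = (w \<bullet> l) * Im l"
      using assms by simp_all
  qed
  ultimately show "w = ((w \<bullet> l) / (l \<bullet> l)) *\<^sub>R l"
    by (auto simp: complex_eq_iff field_simps)
qed

text \<open>Interior points and \<open>l\<close> lie on the same side of the boundary line, so an
  interior point on the line through the base has a positive parameter.\<close>

lemma on_ray_iff: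
  assumes z: "z \<in> interior (disk N)" and i: "i < nb N"
  shows "(\<exists>t>0. z = bv N i + t *\<^sub>R l) \<longleftrightarrow> cross (z - bv N i) l = 0"
proof
  assume "cross (z - bv N i) l = 0"
  then obtain t where t: "z - bv N i = t *\<^sub>R l" by (rule cross_zero_parallel)
  obtain m where "\<forall>z\<in>interior (disk N). \<forall>i<nb N. cross m (z - bv N i) < 0"
    "0 < nb N \<longrightarrow> cross m l < 0"
    "\<forall>i<nb N. \<forall>j<nb N. cross m (bv N i - bv N j) = 0"
    by (rule boundary_side)
  then have "cross m (z - bv N i) < 0" "cross m l < 0"
    using z i by auto
  moreover have "cross m (t *\<^sub>R l) = t * cross m l" by (simp add: cross_def algebra_simps)
  ultimately have "0 < t" by (simp add: t mult_less_0_iff)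
  with t show "\<exists>t>0. z = bv N i + t *\<^sub>R l" by (auto simp: algebra_simps)
qed (auto simp: cross_def)

lemma internal_cross_nonzero:
  assumes "x \<in> internal N" "i < nb N"
  shows "cross (x - bv N i) l \<noteq> 0"
proof
  assume "cross (x - bv N i) l = 0"
  then obtain t where "t > 0" "x = bv N i + t *\<^sub>R l"
    using on_ray_iff[OF internal_interior[OF assms(1)] assms(2)] by auto
  then show False using gauge assms by (auto simp: gauge_direction_def)
qed

lemma sources_less: "i \<in> sources N \<Longrightarrow> i < nb N"
  by (simp add: source_set_def)

lemma finite_sources: "finite (sources N)"
  by (simp add: source_set_def)

text \<open>Between interior points, a segment crosses the ray at \<open>bv N i\<close> iff it crosses the line
  spanned by this ray.\<close>

lemma ray_crossings:
  assumes x: "x \<in> internal N" and y: "y \<in> internal N" and i: "i < nb N"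
  defines "S \<equiv> closed_segment x y \<inter> {bv N i + t *\<^sub>R l |t. 0 < t}"
  shows "finite S" and "(- 1) ^ card S = sgn (cross (x - bv N i) l) * sgn (cross (y - bv N i) l)"
proof -
  define f where "f z = cross (z - bv N i) l" for z
  have seg: "closed_segment x y \<subseteq> interior (disk N)"
    using internal_interior[OF x] internal_interior[OF y] plabic
    by (intro closed_segment_subset convex_interior) (auto simp: plabic_graph_def marked_disk_def)
  have S: "S = {z \<in> closed_segment x y. f z = 0}"
  proof -
    have "(\<exists>t. z = bv N i + t *\<^sub>R l \<and> 0 < t) \<longleftrightarrow> f z = 0" if "z \<in> closed_segment x y" for z
      using on_ray_iff[OF _ i, of z] seg that unfolding f_def by blast
    then show ?thesis unfolding S_def by blast
  qed
  have aff: "f ((1 - s) *\<^sub>R x + s *\<^sub>R y) = (1 - s) * f x + s * f y" for s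
    by (simp add: f_def cross_def algebra_simps)
  have nz: "f x \<noteq> 0" "f y \<noteq> 0"
    using internal_cross_nonzero x y i by (simp_all add: f_def)
  have "(sgn (f x) = sgn (f y) \<longrightarrow> S = {}) \<and> (sgn (f x) \<noteq> sgn (f y) \<longrightarrow> (\<exists>z. S = {z}))"
  proof (intro conjI impI)
    assume eq: "sgn (f x) = sgn (f y)"
    have "f ((1 - s) *\<^sub>R x + s *\<^sub>R y) \<noteq> 0" if s: "0 \<le> s" "s \<le> 1" for s
    proof -
      have "0 < (1 - s) * (f x * sgn (f x)) + s * (f y * sgn (f y))"
      proof (cases "s = 1")
        case True
        then show ?thesis using nz by (simp add: sgn_if)
      next
        case False
        then have "0 < (1 - s) * (f x * sgn (f x))" "0 \<le> s * (f y * sgn (f y))"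
          using s nz by (simp_all add: sgn_if)
        then show ?thesis by linarith
      qed
      also have "\<dots> = f ((1 - s) *\<^sub>R x + s *\<^sub>R y) * sgn (f x)"
        by (simp only: aff eq distrib_right mult.assoc)
      finally show ?thesis by auto
    qed
    then show "S = {}" by (auto simp: S in_segment)
  next
    assume ne: "sgn (f x) \<noteq> sgn (f y)"
    define s where "s = f x / (f x - f y)"
    have d: "f x - f y \<noteq> 0" using ne by auto
    have s: "0 \<le> s" "s \<le> 1"
      using ne nz unfolding s_def by (cases "0 < f x"; cases "0 < f y"; simp add: divide_simps)+
    have zero: "f ((1 - r) *\<^sub>R x + r *\<^sub>R y) = 0 \<longleftrightarrow> r = s" for r
    proof -
      have "f ((1 - r) *\<^sub>R x + r *\<^sub>R y) = f x - r * (f x - f y)"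
        by (simp only: aff) (simp add: left_diff_distrib right_diff_distrib)
      then show ?thesis using d unfolding s_def by (auto simp: eq_divide_eq)
    qed
    have "S = {(1 - s) *\<^sub>R x + s *\<^sub>R y}"
      using s zero by (auto simp: S in_segment)
    then show "\<exists>z. S = {z}" by blast
  qed
  then consider "sgn (f x) = sgn (f y)" "S = {}" | z where "sgn (f x) \<noteq> sgn (f y)" "S = {z}"
    by blast
  then have "finite S \<and> (- 1) ^ card S = sgn (f x) * sgn (f y)"
  proof cases
    case 1 then show ?thesis using nz by (simp add: sgn_if)
  next
    case 2 then show ?thesis using nz by (auto simp: sgn_if split: if_splits)
  qed
  then show "finite S" and "(- 1) ^ card S = sgn (cross (x - bv N i) l) * sgn (cross (y - bv N i) l)"
    by (simp_all add: f_def)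
qed

text \<open>A sign potential: at an internal vertex it counts, modulo 2, the source rays whose line
  has the vertex on a fixed side.\<close>

definition ray_side :: "complex \<Rightarrow> real" where
  "ray_side x = (\<Prod>i\<in>sources N. sgn (cross (x - bv N i) l))"

lemma ray_side_square:
  assumes "x \<in> internal N"
  shows "ray_side x * ray_side x = 1"
  unfolding ray_side_def prod.distrib[symmetric]
  using internal_cross_nonzero[OF assms] by (intro prod.neutral) (auto simp: sgn_if sources_less)

text \<open>Distinct gauge rays are disjoint, being parallel to each other and transversal to the
  line through their base points. Hence the crossings add up ray by ray, and
  \<open>ray_crossings\<close> gives each parity.\<close>

lemma arc_int_sign:
  assumes x: "src a \<in> internal N" and y: "tgt a \<in> internal N"
  shows "(- 1) ^ arc_int N l a = ray_side (src a) * ray_side (tgt a)"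
proof -
  define S where "S i = closed_segment (src a) (tgt a) \<inter> {bv N i + t *\<^sub>R l |t. 0 < t}" for i
  have eq: "arc_segment N a \<inter> {bv N i + t *\<^sub>R l | i t. i \<in> sources N \<and> 0 < t} = (\<Union>i\<in>sources N. S i)"
    by (auto simp: S_def arc_segment_def)
  have "S i \<inter> S j = {}" if ij: "i \<in> sources N" "j \<in> sources N" "i \<noteq> j" for i j
  proof (rule ccontr)
    assume "S i \<inter> S j \<noteq> {}"
    then obtain t t' where t: "bv N i + t *\<^sub>R l = bv N j + t' *\<^sub>R l" by (auto simp: S_def)
    obtain m where "\<forall>z\<in>interior (disk N). \<forall>i<nb N. cross m (z - bv N i) < 0"
      "0 < nb N \<longrightarrow> cross m l < 0"
      "\<forall>i<nb N. \<forall>j<nb N. cross m (bv N i - bv N j) = 0"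
      by (rule boundary_side)
    then have m: "cross m l < 0" "cross m (bv N i - bv N j) = 0"
      using sources_less[OF ij(1)] sources_less[OF ij(2)] by auto
    have d: "bv N i - bv N j = (t' - t) *\<^sub>R l" using t by (simp add: algebra_simps)
    have "cross m ((t' - t) *\<^sub>R l) = (t' - t) * cross m l" by (simp add: cross_def algebra_simps)
    then have "t' = t" using m by (simp add: d)
    then have "bv N i = bv N j" using t by simp
    then show False using bv_inj ij sources_less by blast
  qed
  then have "arc_int N l a = (\<Sum>i\<in>sources N. card (S i))"
    unfolding arc_int_def eq S_def
    using ray_crossings(1)[OF x y] finite_sources sources_less
    by (intro card_UN_disjoint) auto
  then have "(- 1) ^ arc_int N l a = (\<Prod>i\<in>sources N. (- 1 :: real) ^ card (S i))"
    by (simp add: power_sum)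
  also have "\<dots> = ray_side (src a) * ray_side (tgt a)"
    unfolding ray_side_def prod.distrib[symmetric] S_def
    using ray_crossings(2)[OF x y] sources_less by (intro prod.cong) auto
  finally show ?thesis .
qed

text \<open>With opposite directions the second arc would fold back over the first, and the two
  would share a point that is no vertex.\<close>

lemma consecutive_not_opposite:
  assumes a: "a \<in> arcs (graph N)" and c: "c \<in> arcs (graph N)" and ac: "tgt a = src c"
  shows "0 \<notin> closed_segment (arc_dir N a) (arc_dir N c)"
proof
  assume "0 \<in> closed_segment (arc_dir N a) (arc_dir N c)"
  then obtain t where t: "0 \<le> t" "t \<le> 1" "(1 - t) *\<^sub>R arc_dir N a + t *\<^sub>R arc_dir N c = 0"
    by (auto simp: in_segment)
  have nz: "arc_dir N a \<noteq> 0" "arc_dir N c \<noteq> 0" using a c arc_dir_nonzero by auto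
  then have t': "0 < t" "t < 1" using t by (auto simp: less_le)
  define r where "r = (1 - t) / t"
  have r: "0 < r" using t' by (simp add: r_def)
  have dc: "arc_dir N c = - (r *\<^sub>R arc_dir N a)"
  proof -
    have "t *\<^sub>R arc_dir N c = - ((1 - t) *\<^sub>R arc_dir N a)"
      using t(3) by (simp add: add_eq_0_iff)
    then have "(1/t) *\<^sub>R (t *\<^sub>R arc_dir N c) = (1/t) *\<^sub>R (- ((1 - t) *\<^sub>R arc_dir N a))" by simp
    then show ?thesis using t' by (simp add: r_def)
  qed
  \<comment> \<open>The overlap point lies at parameter \<open>1 - s\<close> on the first arc and
    \<open>s / r\<close> on the second; this choice puts it strictly inside the first arc and on the
    second.\<close>
  define s where "s = min 1 r / 2"
  have s: "0 < s" "s < 1" "s / r \<le> 1" "0 \<le> s / r" using r by (auto simp: s_def)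
  define z where "z = tgt a - s *\<^sub>R arc_dir N a"
  have "z = (1 - (1 - s)) *\<^sub>R src a + (1 - s) *\<^sub>R tgt a"
    by (simp add: z_def arc_dir_def algebra_simps)
  then have "z \<in> arc_segment N a" using s unfolding arc_segment_def in_segment
    by (intro exI[of _ "1 - s"]) auto
  moreover have "z = (1 - s / r) *\<^sub>R src c + (s / r) *\<^sub>R tgt c"
  proof -
    have "(1 - s / r) *\<^sub>R src c + (s / r) *\<^sub>R tgt c = src c + (s / r) *\<^sub>R arc_dir N c"
      by (simp add: arc_dir_def algebra_simps)
    also have "\<dots> = z" using r by (simp add: dc z_def ac)
    finally show ?thesis by simp
  qed
  then have "z \<in> arc_segment N c" using s unfolding arc_segment_def in_segment by blast
  moreover have "a \<noteq> c" using ac G.no_loops[OF a] by auto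
  ultimately have "z \<in> {src a, tgt a}" using arc_segments_meet[OF a c] by blast
  moreover have "z \<noteq> tgt a" using s nz by (simp add: z_def)
  moreover have "z - src a = (1 - s) *\<^sub>R arc_dir N a"
    by (simp add: z_def arc_dir_def algebra_simps)
  then have "z \<noteq> src a" using s nz by auto
  ultimately show False by simp
qed

text \<open>No arc is parallel to \<open>l\<close>, so \<open>upper\<close> is decided by the sign
  of \<open>cross\<close> alone, and modulo 2 the direction of rotation is lost. The definitions
  could differ only if the sides differ and \<open>cross u v = 0\<close>; a common half-plane of
  consecutive arcs excludes this.\<close>

lemma turn_sign:
  assumes a: "a \<in> arcs (graph N)" and c: "c \<in> arcs (graph N)" and ac: "tgt a = src c"
  shows "(- 1) powi turn N l a c = crossing l (arc_dir N a) (arc_dir N c)"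
proof -
  define u v where "u = arc_dir N a" and "v = arc_dir N c"
  have nz: "cross u l \<noteq> 0" "cross v l \<noteq> 0" using a c arc_dir_cross by (auto simp: u_def v_def)
  have up: "upper l u \<longleftrightarrow> 0 < cross u l" "upper l v \<longleftrightarrow> 0 < cross v l"
    using nz by (auto simp: upper_def)
  obtain p where p: "0 < p \<bullet> u" "0 < p \<bullet> v"
    using half_plane_of_segment consecutive_not_opposite[OF a c ac] unfolding u_def v_def by blast
  have "cross u v \<noteq> 0" if "upper l u \<noteq> upper l v"
  proof (cases "upper l u")
    case True
    then have "0 < cross u v * (p \<bullet> l)"
      using sgn_cross_half_plane[OF gauge_nonzero p] that by blast
    then show ?thesis by auto
  next
    case False
    then have "0 < cross v u * (p \<bullet> l)"
      using sgn_cross_half_plane[OF gauge_nonzero p(2,1)] that by blast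
    then show ?thesis by (auto simp: cross_swap[of v u])
  qed
  moreover have o: "orient x y = sgn (cross x y)" for x y by (simp add: orient_def cross_def)
  moreover have "cross l v = - cross v l" by (rule cross_swap)
  ultimately have "turn N l a c = (if upper l u \<and> \<not> upper l v \<and> 0 < cross u v then 1
    else if \<not> upper l u \<and> upper l v \<and> \<not> 0 < cross u v then - 1 else 0)"
    unfolding turn_def Let_def u_def[symmetric] v_def[symmetric] up o
    using nz by (auto simp: sgn_1_pos sgn_1_neg)
  then show ?thesis
    unfolding crossing_def u_def[symmetric] v_def[symmetric] by (auto simp: power_int_minus)
qed

section \<open>Multiplicativity of path signs and signs of closed walks\<close>

lemma path_sign_altdef:
  "path_sign N l P = (\<Prod>i<length P - 1. (- 1) powi turn N l (P ! i) (P ! Suc i))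
     * (\<Prod>i<length P. (- 1) ^ arc_int N l (P ! i))"
proof -
  have 1: "(- 1 :: real) powi (\<Sum>i\<in>A. f i) = (\<Prod>i\<in>A. (- 1) powi f i)" if "finite A"
    for f :: "nat \<Rightarrow> int" and A
    using that by induction (simp_all add: power_int_add)
  have 2: "path_int N l P = (\<Sum>i<length P. arc_int N l (P ! i))"
    by (simp add: path_int_def sum_list_sum_nth lessThan_atLeast0)
  show ?thesis
    by (simp add: path_sign_def power_int_add wind_def 1 2 power_sum)
qed

lemma path_sign_singleton: "path_sign N l [a] = (- 1) ^ arc_int N l a"
  by (simp add: path_sign_altdef)

lemma path_sign_Cons:
  assumes "P \<noteq> []"
  shows "path_sign N l (a # P)
    = (- 1) ^ arc_int N l a * (- 1) powi turn N l a (hd P) * path_sign N l P"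
proof -
  obtain b Q where P: "P = b # Q" using assms by (cases P) auto
  show ?thesis
    by (simp add: P path_sign_altdef prod.lessThan_Suc_shift del: prod.lessThan_Suc)
qed

lemma path_sign_append:
  assumes "P \<noteq> []" "Q \<noteq> []"
  shows "path_sign N l (P @ Q) = path_sign N l P * (- 1) powi turn N l (last P) (hd Q) * path_sign N l Q"
  using assms(1)
proof (induction P rule: list_nonempty_induct)
  case (single a)
  then show ?case using assms(2) by (simp add: path_sign_Cons path_sign_singleton)
next
  case (cons a P)
  then show ?case by (simp add: path_sign_Cons)
qed

lemma cas_nth:
  assumes "G.cas u p w" "Suc i < length p"
  shows "tgt (p ! i) = src (p ! Suc i)"
  using assms
proof (induction p arbitrary: u i)
  case (Cons a p)
  then show ?case by (cases i; cases p) auto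
qed simp

lemma cas_last: "G.cas u p w \<Longrightarrow> p \<noteq> [] \<Longrightarrow> tgt (last p) = w"
  by (induction p arbitrary: u) (auto split: if_splits)

lemma cas_hd: "G.cas u p w \<Longrightarrow> p \<noteq> [] \<Longrightarrow> src (hd p) = u"
  by (cases p) auto

text \<open>The walk is a simple polygon, so its turns multiply to -1 by the Umlaufsatz, while each
  \<open>ray_side\<close> occurs twice in the intersection signs. The extra factor is the closing
  turn, which \<open>path_sign\<close> does not include.\<close>

lemma closed_walk_sign:
  assumes c: "set c \<subseteq> arcs (graph N)" "c \<noteq> []" "G.cas u c u" "distinct c"
    and int: "\<And>a. a \<in> set c \<Longrightarrow> src a \<in> internal N"
  shows "path_sign N l c * (- 1) powi turn N l (last c) (hd c) = - 1"
proof -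
  define n where "n = length c"
  define b where "b i = c ! (i mod n)" for i
  define v where "v i = src (b i)" for i
  have n0: "0 < n" using c by (simp add: n_def)
  have bs: "b i \<in> set c" for i using n0 by (simp add: b_def n_def)
  have ba: "b i \<in> arcs (graph N)" for i using bs c by auto
  have next_b: "tgt (b i) = v (Suc i)" for i
  proof (cases "Suc (i mod n) = n")
    case True
    then have "i mod n = n - 1" "Suc i mod n = 0" by (simp_all add: mod_Suc)
    then have "b i = last c" "b (Suc i) = hd c"
      using c(2) by (simp_all add: b_def n_def last_conv_nth hd_conv_nth)
    then show ?thesis using cas_last[OF c(3,2)] cas_hd[OF c(3,2)] by (simp add: v_def)
  next
    case False
    then have "Suc (i mod n) < length c" using n0 by (simp add: n_def Suc_lessI)
    then show ?thesis using cas_nth[OF c(3)] False by (simp add: v_def b_def mod_Suc n_def)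
  qed
  have per: "b (i + n) = b i" for i by (simp add: b_def)
  have b_inj: "i mod n = j mod n" if "b i = b j" for i j
    using that c(4) n0 by (simp add: b_def nth_eq_iff_index_eq n_def)
  have v_inj: "i mod n = j mod n" if "v i = v j" for i j
  proof -
    \<comment> \<open>The index \<open>i + n - 1\<close> is the cyclic predecessor of
      \<open>i\<close>. At a repeated vertex perfectness identifies the two incoming or the two
      outgoing arcs, and the arcs of the walk are distinct.\<close>
    have "b (i + n - 1) = b (j + n - 1) \<or> b i = b j"
    proof (rule in_or_out_unique[of _ _ _ _ "v i"])
      have "tgt (b (k + n - 1)) = v k" for k using next_b[of "k + n - 1"] n0 per[of k] by (simp add: v_def)
      then show "tgt (b (i + n - 1)) = v i" "tgt (b (j + n - 1)) = v i" using that by auto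
    qed (use ba that int bs in \<open>auto simp: v_def\<close>)
    then have "(i + n - 1) mod n = (j + n - 1) mod n \<or> i mod n = j mod n" using b_inj by blast
    moreover have m: "k mod n = Suc ((k + n - 1) mod n) mod n" for k
      using n0 by (simp add: mod_Suc_eq)
    have "i mod n = j mod n" if "(i + n - 1) mod n = (j + n - 1) mod n"
      by (subst m[of i], subst m[of j]) (simp only: that)
    ultimately show ?thesis by blast
  qed
  have ne: "v j \<noteq> v i" if "i < j" "j < i + n" for i j
  proof
    assume "v j = v i"
    then have "n dvd j - i" using v_inj[of j i] that by (simp add: mod_eq_dvd_iff_nat)
    then show False using that by (auto dest!: dvd_imp_le)
  qed
  have dir: "v (Suc i) - v i = arc_dir N (b i)" for i
    by (simp add: arc_dir_def v_def next_b[unfolded v_def])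
  have adj: "0 \<notin> closed_segment (v (Suc i) - v i) (v (Suc (Suc i)) - v (Suc i))" for i
    unfolding dir using ba next_b by (intro consecutive_not_opposite) (auto simp: v_def)
  \<comment> \<open>A closed walk of length 1 is a loop, and one of length 2 runs back along its own
    segment.\<close>
  have n3: "3 \<le> n"
  proof (rule ccontr)
    assume "\<not> 3 \<le> n"
    then consider "n = 1" | "n = 2" using n0 by linarith
    then show False
    proof cases
      case 1
      then have "v (Suc 0) = v 0" using per[of 0] by (simp add: v_def)
      then show False using adj[of 0] dir[of 0] arc_dir_nonzero[OF ba, of 0] by simp
    next
      case 2
      then have e: "v (Suc (Suc 0)) = v 0" using per[of 0] by (simp add: v_def numeral_2_eq_2)
      have "0 \<in> closed_segment (v (Suc 0) - v 0) (v 0 - v (Suc 0))"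
        unfolding in_segment by (intro exI[of _ "1/2"]) (simp add: algebra_simps)
      then show False using adj[of 0] e by simp
    qed
  qed
  have dis: "closed_segment (v i) (v (Suc i)) \<inter> closed_segment (v j) (v (Suc j)) = {}"
    if "Suc i < j" "Suc j < i + n" for i j
  proof -
    have "b i \<noteq> b j" using ne[of i j] that by (auto simp: v_def)
    moreover have "closed_segment (v k) (v (Suc k)) = arc_segment N (b k)" for k
      by (simp add: arc_segment_def v_def next_b[unfolded v_def])
    ultimately have "closed_segment (v i) (v (Suc i)) \<inter> closed_segment (v j) (v (Suc j))
      \<subseteq> {v i, v (Suc i)} \<inter> {v j, v (Suc j)}"
      using arc_segments_meet[OF ba ba, of i j] by (simp add: next_b flip: v_def)
    moreover have "v i \<noteq> v j" "v i \<noteq> v (Suc j)" "v (Suc i) \<noteq> v j" "v (Suc i) \<noteq> v (Suc j)"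
      using ne[of i j] ne[of i "Suc j"] ne[of "Suc i" j] ne[of "Suc i" "Suc j"] that by auto
    ultimately show ?thesis by auto
  qed
  have "(\<Prod>i<n. crossing l (v (Suc i) - v i) (v (Suc (Suc i)) - v (Suc i))) = - 1"
    using per by (intro umlaufsatz_mod_2 gauge_nonzero n3 adj dis ne) (auto simp: v_def)
  then have turns: "(\<Prod>i<n. (- 1 :: real) powi turn N l (b i) (b (Suc i))) = - 1"
    by (simp add: dir turn_sign[OF ba ba next_b[unfolded v_def]])
  have "(\<Prod>i<n. (- 1) ^ arc_int N l (b i)) = (\<Prod>i<n. ray_side (v i) * ray_side (v (Suc i)))"
    using int[OF bs] arc_int_sign next_b by (intro prod.cong) (auto simp: v_def)
  also have "\<dots> = (\<Prod>i<n. ray_side (v i)) * (\<Prod>i<n. ray_side (v (i + 1)))"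
    by (simp add: prod.distrib)
  also have "(\<Prod>i<n. ray_side (v (i + 1))) = (\<Prod>i<n. ray_side (v i))"
    using per by (intro prod_periodic_shift) (simp add: v_def)
  also have "(\<Prod>i<n. ray_side (v i)) * (\<Prod>i<n. ray_side (v i)) = 1"
    unfolding prod.distrib[symmetric] using int[OF bs]
    by (intro prod.neutral) (simp add: ray_side_square v_def)
  finally have ints: "(\<Prod>i<n. (- 1 :: real) ^ arc_int N l (b i)) = 1" .
  obtain k where k: "n = Suc k" using n0 by (cases n) auto
  have "b k = last c" "b n = hd c"
    using c k by (auto simp: b_def n_def last_conv_nth hd_conv_nth)
  moreover have "path_sign N l c = (\<Prod>i<k. (- 1) powi turn N l (b i) (b (Suc i)))
      * (\<Prod>i<n. (- 1) ^ arc_int N l (b i))"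
    unfolding path_sign_altdef n_def[symmetric] using k
    by (intro arg_cong2[of _ _ _ _ "(*)"] prod.cong) (auto simp: b_def)
  ultimately show ?thesis using turns ints k by simp
qed

section \<open>Edge flows and loop-erased walks\<close>

lemma boundary_degree:
  assumes "i < nb N"
  shows "card (in_arcs (graph N) (bv N i)) + card (out_arcs (graph N) (bv N i)) = 1"
  using plabic assms
  by (simp add: plabic_graph_def boundary_def vdegree_def in_degree_def out_degree_def)

lemma source_in_arcs:
  assumes "i \<in> sources N"
  shows "in_arcs (graph N) (bv N i) = {}"
  using boundary_degree[of i] assms G.finite_in_arcs
  by (simp add: source_set_def out_degree_def)

lemma sink_out_arcs:
  assumes "i \<in> sinks N"
  shows "out_arcs (graph N) (bv N i) = {}" and "card (in_arcs (graph N) (bv N i)) = 1"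
proof -
  have "i < nb N" "card (out_arcs (graph N) (bv N i)) \<noteq> 1"
    using assms by (auto simp: sinks_def source_set_def out_degree_def)
  then have "card (out_arcs (graph N) (bv N i)) = 0 \<and> card (in_arcs (graph N) (bv N i)) = 1"
    using boundary_degree[of i] by linarith
  then show "out_arcs (graph N) (bv N i) = {}" "card (in_arcs (graph N) (bv N i)) = 1"
    using G.finite_out_arcs by auto
qed

lemma tgt_not_source: "a \<in> arcs (graph N) \<Longrightarrow> i \<in> sources N \<Longrightarrow> tgt a \<noteq> bv N i"
  using source_in_arcs by (force simp: set_eq_iff)

lemma src_not_sink: "a \<in> arcs (graph N) \<Longrightarrow> j \<in> sinks N \<Longrightarrow> src a \<noteq> bv N j"
  using sink_out_arcs(1) by (force simp: set_eq_iff)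

lemma sink_arc_unique:
  assumes "j \<in> sinks N" "a \<in> arcs (graph N)" "b \<in> arcs (graph N)" "tgt a = bv N j" "tgt b = bv N j"
  shows "a = b"
proof -
  have "a \<in> in_arcs (graph N) (bv N j)" "b \<in> in_arcs (graph N) (bv N j)" using assms by simp_all
  with sink_out_arcs(2)[OF assms(1)] show ?thesis by (elim card_1_singletonE) simp
qed

lemma src_boundary:
  assumes "a \<in> arcs (graph N)" "src a \<in> boundary N"
  obtains i where "i \<in> sources N" "src a = bv N i"
proof -
  obtain i where "i < nb N" "src a = bv N i" using assms(2) by (auto simp: boundary_def)
  then show ?thesis using that src_not_sink[OF assms(1), of i] by (auto simp: sinks_def)
qed

lemma tgt_boundary:
  assumes "a \<in> arcs (graph N)" "tgt a \<in> boundary N"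
  obtains i where "i \<in> sinks N" "tgt a = bv N i"
proof -
  obtain i where "i < nb N" "tgt a = bv N i" using assms(2) by (auto simp: boundary_def)
  then show ?thesis using that tgt_not_source[OF assms(1), of i] by (auto simp: sinks_def)
qed

lemma source_boundary: "i \<in> sources N \<Longrightarrow> bv N i \<in> boundary N"
  by (simp add: source_set_def boundary_def)

lemma sink_boundary: "j \<in> sinks N \<Longrightarrow> bv N j \<in> boundary N"
  by (simp add: sinks_def boundary_def)

lemma internal_iff: "v \<in> verts (graph N) \<Longrightarrow> v \<in> internal N \<longleftrightarrow> v \<notin> boundary N"
  by (simp add: internal_def)

lemma internal_verts: "v \<in> internal N \<Longrightarrow> v \<in> verts (graph N)"
  by (simp add: internal_def)

lemma internal_not_boundary: "v \<in> internal N \<Longrightarrow> v \<notin> boundary N"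
  by (simp add: internal_def)

lemma finite_arc_set: "F \<subseteq> arcs (graph N) \<Longrightarrow> finite F"
  using G.finite_arcs finite_subset by blast

lemma sum_in_out:
  assumes "F \<subseteq> arcs (graph N)"
  shows "(\<Sum>v\<in>verts (graph N). card (F \<inter> in_arcs (graph N) v)) = card F"
    and "(\<Sum>v\<in>verts (graph N). card (F \<inter> out_arcs (graph N) v)) = card F"
proof -
  have fin: "finite F" using assms by (rule finite_arc_set)
  have "(\<Sum>v\<in>verts (graph N). card (F \<inter> in_arcs (graph N) v))
      = card (\<Union>v\<in>verts (graph N). F \<inter> in_arcs (graph N) v)"
    using fin by (subst card_UN_disjoint) auto
  also have "(\<Union>v\<in>verts (graph N). F \<inter> in_arcs (graph N) v) = F" using assms by auto
  finally show "(\<Sum>v\<in>verts (graph N). card (F \<inter> in_arcs (graph N) v)) = card F" .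
  have "(\<Sum>v\<in>verts (graph N). card (F \<inter> out_arcs (graph N) v))
      = card (\<Union>v\<in>verts (graph N). F \<inter> out_arcs (graph N) v)"
    using fin by (subst card_UN_disjoint) auto
  also have "(\<Union>v\<in>verts (graph N). F \<inter> out_arcs (graph N) v) = F" using assms by auto
  finally show "(\<Sum>v\<in>verts (graph N). card (F \<inter> out_arcs (graph N) v)) = card F" .
qed

lemma edge_flowsD:
  assumes "F \<in> edge_flows N e j"
  shows "F \<subseteq> arcs (graph N)" "finite F" "e \<in> F" "e \<in> arcs (graph N)"
    and "\<And>v. v \<in> internal N \<Longrightarrow> v \<noteq> src e \<Longrightarrow>
      card (F \<inter> in_arcs (graph N) v) = card (F \<inter> out_arcs (graph N) v)"
    and "card (F \<inter> in_arcs (graph N) (src e)) + 1 = card (F \<inter> out_arcs (graph N) (src e))"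
    and "\<And>a i. a \<in> F \<Longrightarrow> i \<in> sources N \<Longrightarrow> bv N i \<in> {src a, tgt a} \<Longrightarrow> a = e"
    and "\<exists>a\<in>F. tgt a = bv N j"
  using assms finite_arc_set by (auto simp: edge_flows_def balanced_def)

text \<open>An edge flow loses one unit at its start, so exactly one unit arrives at the boundary.\<close>

lemma edge_flow_tgt_boundary:
  assumes F: "F \<in> edge_flows N e j" and j: "j \<in> sinks N" and a: "a \<in> F" "tgt a \<in> boundary N"
  shows "tgt a = bv N j"
proof (rule ccontr)
  assume ne: "tgt a \<noteq> bv N j"
  note FD = edge_flowsD[OF F]
  \<comment> \<open>Net inflow: it sums to 0, is -1 at the start and nonnegative elsewhere. Two
    different boundary ends would contribute at least 2.\<close>
  define d where "d v = int (card (F \<inter> in_arcs (graph N) v)) - int (card (F \<inter> out_arcs (graph N) v))" for v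
  have total: "(\<Sum>v\<in>verts (graph N). d v) = 0"
    using sum_in_out[OF FD(1)] by (simp add: d_def sum_subtractf flip: of_nat_sum)
  have d_boundary: "d v = int (card (F \<inter> in_arcs (graph N) v))"
    if v: "v \<in> boundary N" "v \<noteq> src e" for v
  proof -
    have "F \<inter> out_arcs (graph N) v = {}"
    proof (rule ccontr)
      assume "F \<inter> out_arcs (graph N) v \<noteq> {}"
      then obtain b where "b \<in> F \<inter> out_arcs (graph N) v" by blast
      then have b: "b \<in> F" "b \<in> arcs (graph N)" "src b = v" by auto
      then obtain i where "i \<in> sources N" "src b = bv N i" using v src_boundary by metis
      then show False using FD(7)[OF b(1)] b v by auto
    qed
    then show ?thesis by (simp add: d_def)
  qed
  have nonneg: "0 \<le> d v" if "v \<in> verts (graph N) - {src e}" for v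
    using that FD(5)[of v] d_boundary[of v] internal_iff[of v] by (auto simp: d_def)
  have pos: "1 \<le> d (tgt b)" "tgt b \<in> verts (graph N) - {src e}" if b: "b \<in> F" "tgt b \<in> boundary N" for b
  proof -
    have ba: "b \<in> arcs (graph N)" using b FD(1) by auto
    then obtain i where i: "i \<in> sinks N" "tgt b = bv N i" using b tgt_boundary by metis
    then have n: "tgt b \<noteq> src e" using src_not_sink[OF FD(4)] by metis
    then show "tgt b \<in> verts (graph N) - {src e}" using ba by simp
    have "b \<in> F \<inter> in_arcs (graph N) (tgt b)" using b ba by simp
    then have "card (F \<inter> in_arcs (graph N) (tgt b)) \<noteq> 0" using FD(2) by auto
    then show "1 \<le> d (tgt b)" using d_boundary[OF b(2) n] by simp
  qed
  obtain b where b: "b \<in> F" "tgt b = bv N j" using FD(8) by blast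
  have p: "1 \<le> d (tgt a)" "tgt a \<in> verts (graph N) - {src e}"
    "1 \<le> d (tgt b)" "tgt b \<in> verts (graph N) - {src e}"
    using pos[OF a] pos[OF b(1)] b(2) sink_boundary[OF j] by auto
  have "(\<Sum>v\<in>{tgt a, tgt b}. d v) \<le> (\<Sum>v\<in>verts (graph N) - {src e}. d v)"
    using p nonneg by (intro sum_mono2) auto
  moreover have "(\<Sum>v\<in>{tgt a, tgt b}. d v) \<ge> 2" using p ne b(2) by simp
  moreover have "(\<Sum>v\<in>verts (graph N). d v) = d (src e) + (\<Sum>v\<in>verts (graph N) - {src e}. d v)"
    using FD(4) by (intro sum.remove) auto
  moreover have "d (src e) = - 1" using FD(6) by (simp add: d_def)
  ultimately show False using total by linarith
qed

lemma walk_balance: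
  assumes "G.cas u p w" "distinct p" "set p \<subseteq> arcs (graph N)"
  shows "card (set p \<inter> in_arcs (graph N) x) + (if x = u then 1 else 0)
    = card (set p \<inter> out_arcs (graph N) x) + (if x = w then 1 else 0)"
  using assms
proof (induction p arbitrary: u)
  case (Cons a p)
  have ins: "insert a (set p) \<inter> X = (if a \<in> X then insert a (set p \<inter> X) else set p \<inter> X)" for X
    by auto
  have IH: "card (set p \<inter> in_arcs (graph N) x) + (if x = tgt a then 1 else 0)
    = card (set p \<inter> out_arcs (graph N) x) + (if x = w then 1 else 0)"
    using Cons by auto
  show ?case
    using Cons.prems IH by (auto simp: ins)
qed simp

lemma paths_Cons_iff:
  "P \<in> paths N e j \<longleftrightarrow> e \<in> arcs (graph N) \<and>
     (P = [e] \<and> tgt e = bv N j \<or> (\<exists>f Q. P = e # Q \<and> src f = tgt e \<and> Q \<in> paths N f j))"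
proof (cases P)
  case (Cons a Q)
  then show ?thesis
    by (cases Q) (auto simp: paths_def G.awalk_Cons_iff G.awalk_Nil_iff dest: G.head_in_verts)
qed (simp add: paths_def)

lemma pathsD:
  assumes "P \<in> paths N e j"
  shows "P \<noteq> []" "hd P = e" "G.cas (src e) P (bv N j)" "set P \<subseteq> arcs (graph N)" "e \<in> arcs (graph N)"
    "e \<in> set P"
  using assms by (auto simp: paths_def G.awalk_def)

lemma conservative_flowsD:
  assumes "C \<in> conservative_flows N"
  shows "C \<subseteq> arcs (graph N)" "finite C"
    and "\<And>a. a \<in> C \<Longrightarrow> src a \<notin> boundary N" "\<And>a. a \<in> C \<Longrightarrow> tgt a \<notin> boundary N"
    and "\<And>v. v \<in> internal N \<Longrightarrow> card (C \<inter> in_arcs (graph N) v) = card (C \<inter> out_arcs (graph N) v)"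
  using assms finite_arc_set by (auto simp: conservative_flows_def balanced_def)

text \<open>The flow and the walk have the same imbalance at every internal vertex, and the walk
  contains the only possible boundary arcs of the flow, namely \<open>e\<close> and the arc into the
  sink. The condition on the complement in \<open>flow_walk\<close> is thus automatic.\<close>

lemma edge_flow_minus_path:
  assumes F: "F \<in> edge_flows N e j" and j: "j \<in> sinks N"
    and P: "P \<in> paths N e j" "distinct P" "set P \<subseteq> F"
  shows "F - set P \<in> conservative_flows N"
  unfolding conservative_flows_def mem_Collect_eq
proof (intro conjI ballI)
  note FD = edge_flowsD[OF F] and PD = pathsD[OF P(1)]
  show "F - set P \<subseteq> arcs (graph N)" using FD(1) by blast
  fix a assume a: "a \<in> F - set P"
  then have aa: "a \<in> arcs (graph N)" using FD(1) by blast
  show "src a \<notin> boundary N"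
  proof
    assume "src a \<in> boundary N"
    then obtain i where "i \<in> sources N" "src a = bv N i" using aa src_boundary by metis
    then have "a = e" using FD(7) a by auto
    then show False using a PD(6) by simp
  qed
  show "tgt a \<notin> boundary N"
  proof
    assume "tgt a \<in> boundary N"
    then have "tgt a = bv N j" using edge_flow_tgt_boundary[OF F j] a by blast
    moreover have "last P \<in> arcs (graph N)" using PD(1,4) last_in_set by blast
    ultimately have "a = last P" using sink_arc_unique[OF j aa] cas_last[OF PD(3,1)] by blast
    then show False using a PD(1) by simp
  qed
next
  note FD = edge_flowsD[OF F] and PD = pathsD[OF P(1)]
  fix v assume v: "v \<in> internal N"
  have diff: "card ((F - set P) \<inter> X) = card (F \<inter> X) - card (set P \<inter> X)" for X
  proof -
    have "(F - set P) \<inter> X = F \<inter> X - set P \<inter> X" by blast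
    then show ?thesis using P(3) by (simp add: card_Diff_subset inf.coboundedI1 Int_mono)
  qed
  have "v \<noteq> bv N j" using v sink_boundary[OF j] internal_not_boundary by blast
  then have "card (set P \<inter> in_arcs (graph N) v) + (if v = src e then 1 else 0)
      = card (set P \<inter> out_arcs (graph N) v)"
    using walk_balance[OF PD(3) P(2) PD(4), of v] by simp
  moreover have "card (F \<inter> in_arcs (graph N) v) + (if v = src e then 1 else 0)
      = card (F \<inter> out_arcs (graph N) v)"
    using FD(5)[OF v] FD(6) by auto
  ultimately show "balanced N (F - set P) v"
    by (auto simp: balanced_def diff split: if_splits)
qed

section \<open>Adding and removing the first arc of a flow\<close>

lemma insert_Int_arcs:
  "insert e F \<inter> in_arcs (graph N) v
     = (if e \<in> arcs (graph N) \<and> tgt e = v then insert e (F \<inter> in_arcs (graph N) v) else F \<inter> in_arcs (graph N) v)"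
  "insert e F \<inter> out_arcs (graph N) v
     = (if e \<in> arcs (graph N) \<and> src e = v then insert e (F \<inter> out_arcs (graph N) v) else F \<inter> out_arcs (graph N) v)"
  by auto

text \<open>Balance and the incoming arc \<open>e\<close> force an outgoing arc. With two of them,
  perfectness would leave \<open>e\<close> as the only incoming arc, against balance.\<close>

lemma edge_flow_next:
  assumes F: "F \<in> edge_flows N e j" and v: "tgt e \<in> internal N"
  obtains f where "F \<inter> out_arcs (graph N) (tgt e) = {f}"
proof -
  note FD = edge_flowsD[OF F]
  let ?I = "F \<inter> in_arcs (graph N) (tgt e)" and ?O = "F \<inter> out_arcs (graph N) (tgt e)"
  have fin: "finite ?I" "finite ?O" using FD(2) by auto
  have eI: "e \<in> ?I" using FD by simp
  have eq: "card ?I = card ?O" using FD(5)[OF v] G.no_loops[OF FD(4)] by auto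
  moreover have "card ?I \<noteq> 0" using eI fin by auto
  ultimately have "?O \<noteq> {}" by (metis card.empty)
  then obtain f where f: "f \<in> ?O" by blast
  have "g = f" if g: "g \<in> ?O" for g
  proof (rule ccontr)
    assume ne: "g \<noteq> f"
    have "a = e" if "a \<in> ?I" for a
      using in_or_out_unique[of a e g f "tgt e"] that eI g f ne v by auto
    then have "?I = {e}" using eI by blast
    then have "card ?O = 1" using eq by simp
    then show False using f g ne by (elim card_1_singletonE) auto
  qed
  then have "?O = {f}" using f by blast
  then show ?thesis by (rule that)
qed

text \<open>Deleting \<open>e\<close> moves the missing unit of inflow from the tail of
  \<open>e\<close> to its head, the tail of \<open>f\<close>.\<close>

lemma edge_flow_remove:
  assumes F: "F \<in> edge_flows N e j" and j: "j \<in> sinks N" and v: "tgt e \<in> internal N"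
    and f: "f \<in> F" "src f = tgt e"
  shows "F - {e} \<in> edge_flows N f j"
proof -
  note FD = edge_flowsD[OF F]
  obtain H where H: "F = insert e H" "e \<notin> H" using FD(3) by (metis mk_disjoint_insert)
  have finH: "finite H" using FD(2) H by simp
  have loop: "src e \<noteq> tgt e" using G.no_loops[OF FD(4)] .
  have "f \<noteq> e" using f loop by auto
  then have fH: "f \<in> H" using f H by simp
  have bal: "balanced N H u" if u: "u \<in> internal N" "u \<noteq> src f" for u
  proof (cases "u = src e")
    case True
    then show ?thesis using FD(6) H finH FD(4) loop by (auto simp: insert_Int_arcs balanced_def)
  next
    case False
    then show ?thesis using FD(5)[OF u(1) False] u f(2) H by (auto simp: insert_Int_arcs balanced_def)
  qed
  have start: "card (H \<inter> in_arcs (graph N) (src f)) + 1 = card (H \<inter> out_arcs (graph N) (src f))"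
    using FD(5)[of "src f"] v loop f(2) H finH FD(4) by (auto simp: insert_Int_arcs)
  have no_source: "\<not> (i \<in> sources N \<and> bv N i \<in> {src a, tgt a})" if "a \<in> H" for a i
    using FD(7)[of a i] that H by auto
  obtain a where a: "a \<in> F" "tgt a = bv N j" using FD(8) by blast
  then have "a \<noteq> e" using v sink_boundary[OF j] internal_not_boundary by metis
  then have "\<exists>a\<in>H. tgt a = bv N j" using a H by auto
  then have "H \<in> edge_flows N f j"
    unfolding edge_flows_def using FD(1) H fH bal start no_source by blast
  then show ?thesis using H by simp
qed

lemma edge_flow_insert:
  assumes H: "H \<in> edge_flows N f j" and e: "e \<in> arcs (graph N)" "e \<notin> H"
    and v: "tgt e \<in> internal N" and f: "src f = tgt e"
  shows "insert e H \<in> edge_flows N e j"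
proof -
  note HD = edge_flowsD[OF H]
  have loop: "src e \<noteq> tgt e" using G.no_loops[OF e(1)] .
  have no_source: "bv N i \<notin> {src a, tgt a}" if a: "a \<in> H" and i: "i \<in> sources N" for a i
  proof
    assume b: "bv N i \<in> {src a, tgt a}"
    then have "a = f" using HD(7) a i by blast
    then have "bv N i = tgt f" using b f v source_boundary[OF i] internal_not_boundary by auto
    then show False using tgt_not_source[OF HD(4) i] by simp
  qed
  have bal: "balanced N (insert e H) u" if u: "u \<in> internal N" "u \<noteq> src e" for u
  proof (cases "u = tgt e")
    case True
    then show ?thesis using HD(2,6) f e loop by (auto simp: insert_Int_arcs balanced_def)
  next
    case False
    then show ?thesis using HD(5)[OF u(1)] u f e by (auto simp: insert_Int_arcs balanced_def)
  qed
  have start: "card (insert e H \<inter> in_arcs (graph N) (src e)) + 1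
      = card (insert e H \<inter> out_arcs (graph N) (src e))"
  proof (cases "src e \<in> internal N")
    case True
    then show ?thesis using HD(5)[OF True] HD(2) loop f e by (auto simp: insert_Int_arcs)
  next
    case False
    then have "src e \<in> boundary N" using internal_iff e by auto
    then obtain i where i: "i \<in> sources N" "src e = bv N i" using src_boundary e by metis
    then have "H \<inter> in_arcs (graph N) (src e) = {}" "H \<inter> out_arcs (graph N) (src e) = {}"
      using no_source by fastforce+
    then show ?thesis using loop e by (simp add: insert_Int_arcs)
  qed
  show ?thesis
    unfolding edge_flows_def using HD(1,8) e bal start no_source by blast
qed

lemma edge_flow_insert_conservative:
  assumes C: "C \<in> conservative_flows N" and e: "e \<in> arcs (graph N)" "tgt e = bv N j"
    and j: "j \<in> sinks N"
  shows "e \<notin> C" and "insert e C \<in> edge_flows N e j"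
proof -
  note CD = conservative_flowsD[OF C]
  show eC: "e \<notin> C" using CD(4) e sink_boundary[OF j] by metis
  have loop: "src e \<noteq> tgt e" using G.no_loops[OF e(1)] .
  have tgt: "tgt e \<notin> internal N" using e sink_boundary[OF j] internal_not_boundary by metis
  have bal: "balanced N (insert e C) u" if u: "u \<in> internal N" "u \<noteq> src e" for u
    using CD(5)[OF u(1)] u tgt by (auto simp: insert_Int_arcs balanced_def)
  have start: "card (insert e C \<inter> in_arcs (graph N) (src e)) + 1
      = card (insert e C \<inter> out_arcs (graph N) (src e))"
  proof (cases "src e \<in> internal N")
    case True
    then show ?thesis using CD(5)[OF True] CD(2) loop e eC by (auto simp: insert_Int_arcs)
  next
    case False
    then have b: "src e \<in> boundary N" using internal_iff e by auto
    then have "C \<inter> in_arcs (graph N) (src e) = {}" "C \<inter> out_arcs (graph N) (src e) = {}"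
      using CD(3,4) by fastforce+
    then show ?thesis using loop e by (simp add: insert_Int_arcs)
  qed
  have no_source: "bv N i \<notin> {src a, tgt a}" if "a \<in> C" "i \<in> sources N" for a i
    using CD(3,4)[OF that(1)] source_boundary[OF that(2)] by auto
  show "insert e C \<in> edge_flows N e j"
    unfolding edge_flows_def using CD(1) e bal start no_source by blast
qed

lemma tgt_cases:
  assumes "e \<in> arcs (graph N)"
  obtains "tgt e \<in> internal N" | "tgt e \<in> boundary N"
  using internal_iff[OF G.head_in_verts[OF assms]] by blast

text \<open>Follow the unique next arc and delete the arcs already used. The flow shrinks, so no arc
  repeats and the walk stops; it can stop only at a boundary vertex, which must be the sink.\<close>

lemma flow_walk_exists:
  assumes "F \<in> edge_flows N e j" "j \<in> sinks N"
  shows "\<exists>P. P \<in> paths N e j \<and> distinct P \<and> set P \<subseteq> F"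
  using assms
proof (induction "card F" arbitrary: F e)
  case 0
  then show ?case using edge_flowsD(2,3)[OF 0(2)] by auto
next
  case (Suc n)
  note FD = edge_flowsD[OF Suc.prems(1)]
  from FD(4) show ?case
  proof (cases rule: tgt_cases)
    case 1
    obtain f where f: "F \<inter> out_arcs (graph N) (tgt e) = {f}"
      using edge_flow_next[OF Suc.prems(1) 1] by metis
    then have f': "f \<in> F" "src f = tgt e" by auto
    have "F - {e} \<in> edge_flows N f j" by (rule edge_flow_remove[OF Suc.prems 1 f'])
    moreover have "n = card (F - {e})" using Suc.hyps(2) FD by simp
    ultimately obtain P where "P \<in> paths N f j" "distinct P" "set P \<subseteq> F - {e}"
      using Suc.hyps(1) Suc.prems(2) by blast
    then show ?thesis
      using FD f' by (intro exI[of _ "e # P"]) (auto simp: paths_Cons_iff[of "e # P"])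
  next
    case 2
    then have "tgt e = bv N j" using edge_flow_tgt_boundary[OF Suc.prems FD(3)] by simp
    then show ?thesis using FD by (intro exI[of _ "[e]"]) (auto simp: paths_Cons_iff[of "[e]"])
  qed
qed

text \<open>Every step is forced by \<open>edge_flow_next\<close>, and the sink has no outgoing arc
  along which a walk could go on.\<close>

lemma flow_walk_unique:
  assumes "F \<in> edge_flows N e j" "j \<in> sinks N"
    and "P \<in> paths N e j" "distinct P" "set P \<subseteq> F"
    and "P' \<in> paths N e j" "distinct P'" "set P' \<subseteq> F"
  shows "P = P'"
  using assms
proof (induction P arbitrary: F e P')
  case Nil
  then show ?case using pathsD by blast
next
  case (Cons a Q)
  note FD = edge_flowsD[OF Cons.prems(1)]
  have ends: "R = [e]" if "R \<in> paths N e j" "tgt e = bv N j" for R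
    using that src_not_sink[OF _ Cons.prems(2)] pathsD(5) by (subst (asm) paths_Cons_iff) metis
  show ?case
  proof (cases "tgt e = bv N j")
    case True
    then show ?thesis using ends Cons.prems by metis
  next
    case False
    then have v: "tgt e \<in> internal N"
      using edge_flow_tgt_boundary[OF Cons.prems(1,2) FD(3)] internal_iff FD(4) by auto
    obtain f where f: "F \<inter> out_arcs (graph N) (tgt e) = {f}"
      using edge_flow_next[OF Cons.prems(1) v] by metis
    have step: "\<exists>R'. R = e # R' \<and> R' \<in> paths N f j"
      if R: "R \<in> paths N e j" "set R \<subseteq> F" for R
    proof -
      obtain g R' where g: "R = e # R'" "src g = tgt e" "R' \<in> paths N g j"
        using R(1) False by (subst (asm) paths_Cons_iff) metis
      then have "g \<in> F \<inter> out_arcs (graph N) (tgt e)" using pathsD(5,6)[OF g(3)] R(2) by auto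
      then have "g = f" using f by simp
      then show ?thesis using g by blast
    qed
    obtain R where R: "a # Q = e # R" "R \<in> paths N f j" using step Cons.prems(3,5) by metis
    obtain R' where R': "P' = e # R'" "R' \<in> paths N f j" using step Cons.prems(6,8) by metis
    have "F - {e} \<in> edge_flows N f j"
      using f by (intro edge_flow_remove[OF Cons.prems(1,2) v]) auto
    then have "Q = R'" using Cons.IH[of "F - {e}" f R'] R R' Cons.prems by auto
    then show ?thesis using R R' by simp
  qed
qed

lemma flow_walk_eq:
  assumes "F \<in> edge_flows N e j" "j \<in> sinks N" "P \<in> paths N e j" "distinct P" "set P \<subseteq> F"
  shows "flow_walk N e j F = P"
  unfolding flow_walk_def
  using assms edge_flow_minus_path[OF assms] flow_walk_unique[OF assms(1,2)]
  by (intro the_equality) auto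

lemma flow_walk_props:
  assumes "F \<in> edge_flows N e j" "j \<in> sinks N"
  shows "flow_walk N e j F \<in> paths N e j" "distinct (flow_walk N e j F)" "set (flow_walk N e j F) \<subseteq> F"
  using flow_walk_exists[OF assms] flow_walk_eq[OF assms] by auto

lemma flow_sign_base:
  assumes "F \<in> edge_flows N e j" "j \<in> sinks N" "tgt e = bv N j"
  shows "flow_sign N l e j F = (- 1) ^ arc_int N l e"
proof -
  have "flow_walk N e j F = [e]"
    using assms edge_flowsD[OF assms(1)] by (intro flow_walk_eq) (auto simp: paths_Cons_iff[of "[e]"])
  then show ?thesis by (simp add: flow_sign_def path_sign_singleton)
qed

lemma flow_sign_step:
  assumes "F \<in> edge_flows N e j" "j \<in> sinks N" "tgt e \<in> internal N" "f \<in> F" "src f = tgt e"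
  shows "flow_sign N l e j F
    = (- 1) ^ arc_int N l e * (- 1) powi turn N l e f * flow_sign N l f j (F - {e})"
proof -
  have H: "F - {e} \<in> edge_flows N f j" by (rule edge_flow_remove[OF assms])
  note P = flow_walk_props[OF H assms(2)]
  have "flow_walk N e j F = e # flow_walk N f j (F - {e})"
    using P edge_flowsD(3,4)[OF assms(1)] assms(5)
    by (intro flow_walk_eq[OF assms(1,2)]) (auto simp: paths_Cons_iff[of "e # _"])
  then show ?thesis
    using pathsD(1,2)[OF P(1)] by (simp add: flow_sign_def path_sign_Cons)
qed

section \<open>Cancellation for flows that already contain the arc to be prepended\<close>

lemma cas_append: "G.cas u (p @ q) w \<longleftrightarrow> (\<exists>x. G.cas u p x \<and> G.cas x q w)"
  by (induction p arbitrary: u) auto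

text \<open>A flow from \<open>f\<close> that passes through the tail of \<open>f\<close> again, by \<open>e\<close>, is also a flow from the
  other outgoing arc \<open>g\<close>. One of the two walks is the other one preceded by a simple closed walk,
  whose sign is negative.\<close>

lemma flow_sign_cancel:
  assumes Ff: "F \<in> edge_flows N f j" and Fg: "F \<in> edge_flows N g j" and j: "j \<in> sinks N"
    and v: "src f = v" "src g = v" "v \<in> internal N" and ne: "f \<noteq> g"
    and ins: "F \<inter> in_arcs (graph N) v = {e}"
    and g: "g \<in> set (flow_walk N f j F)"
  shows "(- 1) powi turn N l e f * flow_sign N l f j F + (- 1) powi turn N l e g * flow_sign N l g j F = 0"
proof -
  note P = flow_walk_props[OF Ff j] and FD = edge_flowsD[OF Ff]
  note PD = pathsD[OF P(1)]
  obtain c R where cR: "flow_walk N f j F = c @ g # R" using g by (meson split_list)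
  have c: "c \<noteq> []" "hd c = f" using cR PD(2) ne by (cases c; simp)+
  obtain x where x: "G.cas v c x" "G.cas x (g # R) (bv N j)" using PD(3) v cR cas_append by metis
  then have xv: "x = v" using v by simp
  have cF: "set c \<subseteq> F" using P(3) cR by auto
  have "last c \<in> F" "tgt (last c) = v" using c cF cas_last[OF x(1)] xv last_in_set by blast+
  then have "last c \<in> F \<inter> in_arcs (graph N) v" using FD(1) by auto
  then have lc: "last c = e" using ins by simp
  \<comment> \<open>Only \<open>f\<close> could touch a boundary source, and its tail
    \<open>v\<close> is internal.\<close>
  have int: "src a \<in> internal N" if a: "a \<in> set c" for a
  proof (rule ccontr)
    have aF: "a \<in> F" "a \<in> arcs (graph N)" using a cF FD(1) by auto
    assume "src a \<notin> internal N"
    then have "src a \<in> boundary N" using internal_iff aF by auto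
    moreover from this obtain i where "i \<in> sources N" "src a = bv N i" using src_boundary aF by metis
    then have "a = f" using FD(7) aF by auto
    ultimately show False using v internal_not_boundary by blast
  qed
  have cyc: "path_sign N l c * (- 1) powi turn N l e f = - 1"
    using closed_walk_sign[of c v] x(1) c lc xv cF FD(1) P(2) cR int by auto
  have "g # R \<in> paths N g j"
    using x xv v internal_verts[OF v(3)] PD(4) cR edge_flowsD(4)[OF Fg] unfolding paths_def G.awalk_def by auto
  then have wg: "flow_walk N g j F = g # R"
    using P cR by (intro flow_walk_eq[OF Fg j]) auto
  \<comment> \<open>The turn from \<open>e\<close> into \<open>g\<close> joins the cycle to the
    remaining walk, while the turn from \<open>e\<close> into \<open>f\<close> closes the
    cycle.\<close>
  have "flow_sign N l f j F = path_sign N l c * (- 1) powi turn N l e g * flow_sign N l g j F"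
    unfolding flow_sign_def wg cR using path_sign_append[OF c(1), of "g # R"] lc by simp
  then have "(- 1) powi turn N l e f * flow_sign N l f j F
      = (path_sign N l c * (- 1) powi turn N l e f) * ((- 1) powi turn N l e g * flow_sign N l g j F)"
    by simp
  then show ?thesis by (simp only: cyc)
qed

text \<open>Otherwise the walk from \<open>g\<close> starts in the conservative complement
  \<open>Q\<close> of the walk from \<open>f\<close> and can never leave it, although
  \<open>Q\<close> has no arc at the boundary and the walk ends there.\<close>

lemma flow_walks_meet:
  assumes Ff: "F \<in> edge_flows N f j" and Fg: "F \<in> edge_flows N g j" and j: "j \<in> sinks N"
    and v: "src f = v" "src g = v" "v \<in> internal N"
  shows "g \<in> set (flow_walk N f j F) \<or> f \<in> set (flow_walk N g j F)"
proof (rule ccontr)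
  assume "\<not> ?thesis"
  then have n: "g \<notin> set (flow_walk N f j F)" "f \<notin> set (flow_walk N g j F)" by auto
  note Pf = flow_walk_props[OF Ff j] and Pg = flow_walk_props[OF Fg j] and FD = edge_flowsD[OF Ff]
  note PfD = pathsD[OF Pf(1)] and PgD = pathsD[OF Pg(1)]
  define Q where "Q = F - set (flow_walk N f j F)"
  have "Q \<in> conservative_flows N"
    unfolding Q_def by (rule edge_flow_minus_path[OF Ff j Pf])
  note QD = conservative_flowsD[OF this]
  have "set R \<subseteq> Q" if "G.cas u R w" "set R \<subseteq> F" "R \<noteq> []" "hd R \<in> Q" "f \<notin> set R" for u R w
    using that
  proof (induction R arbitrary: u)
    case (Cons a R)
    show ?case
    proof (cases R)
      case Nil
      then show ?thesis using Cons by simp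
    next
      case (Cons b R')
      have ab: "tgt a = src b" "a \<in> Q" "a \<in> arcs (graph N)" "b \<in> F" "b \<in> arcs (graph N)"
        using Cons.prems FD(1) Cons QD(1) by auto
      have u: "tgt a \<in> internal N" using QD(4)[OF ab(2)] internal_iff ab(3) by auto
      \<comment> \<open>Switching from \<open>Q\<close> to an arc \<open>b\<close> of the other walk
        would need a vertex entered by \<open>a\<close> and by the predecessor of \<open>b\<close>,
        and left by \<open>b\<close> and by an arc of \<open>Q\<close>. The predecessor exists since
        \<open>b\<close> is not the first arc \<open>f\<close>.\<close>
      have "b \<in> Q"
      proof (rule ccontr)
        assume bQ: "b \<notin> Q"
        then have "b \<in> set (flow_walk N f j F)" using ab(4) by (simp add: Q_def)
        then obtain p q where pq: "flow_walk N f j F = p @ b # q" by (meson split_list)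
        have p: "p \<noteq> []" using pq PfD(2) Cons.prems(5) Cons by (cases p) auto
        obtain x where "G.cas (src f) p x" "G.cas x (b # q) (bv N j)"
          using PfD(3) pq cas_append by metis
        then have lp: "tgt (last p) = tgt a" using cas_last[OF _ p] ab(1) by auto
        have lpP: "last p \<in> set (flow_walk N f j F)" using pq p by simp
        have "a \<in> Q \<inter> in_arcs (graph N) (tgt a)" using ab by simp
        then have "card (Q \<inter> in_arcs (graph N) (tgt a)) \<noteq> 0" using QD(2) by auto
        then have "card (Q \<inter> out_arcs (graph N) (tgt a)) \<noteq> 0" using QD(5)[OF u] by simp
        then obtain d where d: "d \<in> Q" "d \<in> arcs (graph N)" "src d = tgt a"
          by (metis Int_iff card.empty ex_in_conv in_out_arcs_conv)
        have "a = last p \<or> b = d"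
          using lpP PfD(4) by (intro in_or_out_unique[OF ab(3) _ ab(5) d(2) refl lp _ d(3) u]) (auto simp: ab)
        then show False using bQ d(1) ab(2) lpP by (auto simp: Q_def)
      qed
      then show ?thesis using Cons.IH[of "tgt a"] Cons.prems ab Cons by auto
    qed
  qed simp
  then have sub: "set (flow_walk N g j F) \<subseteq> Q"
    using PgD n edge_flowsD(3)[OF Fg] Pg by (auto simp: Q_def)
  have "last (flow_walk N g j F) \<in> Q" using sub PgD(1) by auto
  moreover have "tgt (last (flow_walk N g j F)) \<in> boundary N"
    using cas_last[OF PgD(3,1)] sink_boundary[OF j] by simp
  ultimately show False using QD(4) by blast
qed

text \<open>If some term is nonzero, \<open>F\<close> has at least two arcs out of the head of
  \<open>e\<close>, so \<open>e\<close> is the only one into it and exactly two leave.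
  \<open>F\<close> is then a flow from each of them, and the two terms cancel.\<close>

lemma flow_sign_sum_zero:
  assumes F: "F \<subseteq> arcs (graph N)" "e \<in> F" and v: "tgt e \<in> internal N" and j: "j \<in> sinks N"
  shows "(\<Sum>f\<in>out_arcs (graph N) (tgt e).
    if F \<in> edge_flows N f j then (- 1) powi turn N l e f * flow_sign N l f j F else 0) = 0"
proof (cases "\<exists>f\<in>out_arcs (graph N) (tgt e). F \<in> edge_flows N f j")
  case True
  let ?v = "tgt e"
  let ?I = "F \<inter> in_arcs (graph N) ?v" and ?O = "F \<inter> out_arcs (graph N) ?v"
  obtain f where f: "f \<in> out_arcs (graph N) ?v" "F \<in> edge_flows N f j" using True by blast
  note FD = edge_flowsD[OF f(2)]
  have sf: "src f = ?v" using f by simp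
  have eI: "e \<in> ?I" using F by auto
  have fO: "f \<in> ?O" using f FD by simp
  have fin: "finite ?I" "finite ?O" using FD(2) by auto
  have card: "card ?I + 1 = card ?O" using FD(6) sf by simp
  have "card ?I \<noteq> 0" using eI fin by auto
  then have "2 \<le> card ?O" using card by linarith
  then have "?O \<noteq> {f}" by auto
  then obtain g where g: "g \<in> ?O" "g \<noteq> f" using fO by blast
  have "a = e" if "a \<in> ?I" for a
    using in_or_out_unique[of a e f g ?v] that eI g fO v by auto
  then have I: "?I = {e}" using eI by blast
  then have "card ?O = card {f, g}" using card g by simp
  then have O: "?O = {f, g}" using fin fO g by (intro card_subset_eq[symmetric]) auto
  have sg: "src g = ?v" "g \<in> F" using g by auto
  have no: "bv N i \<notin> {src a, tgt a}" if a: "a \<in> F" "i \<in> sources N" for a i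
  proof
    assume b: "bv N i \<in> {src a, tgt a}"
    then have "a = f" using FD(7) a by blast
    then have "bv N i = tgt f" using b sf v source_boundary[OF a(2)] internal_not_boundary by auto
    then show False using tgt_not_source[OF FD(4) a(2)] by simp
  qed
  \<comment> \<open>The definition refers to the first arc only through its tail, its membership and
    the exemption at sources, which \<open>no\<close> shows to be vacuous.\<close>
  have Fg: "F \<in> edge_flows N g j"
    using f(2) sf sg no unfolding edge_flows_def by auto
  have "{h \<in> out_arcs (graph N) ?v. F \<in> edge_flows N h j} = {f, g}"
    using f Fg sg O FD(1) edge_flowsD(3) by blast
  then have "(\<Sum>h\<in>out_arcs (graph N) ?v.
      if F \<in> edge_flows N h j then (- 1) powi turn N l e h * flow_sign N l h j F else 0)
    = (- 1) powi turn N l e f * flow_sign N l f j F + (- 1) powi turn N l e g * flow_sign N l g j F"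
    using g(2) by (simp add: sum.inter_filter[symmetric] G.finite_out_arcs)
  also have "\<dots> = 0"
  proof (cases "g \<in> set (flow_walk N f j F)")
    case True
    then show ?thesis using flow_sign_cancel[OF f(2) Fg j sf sg(1) v _ I] g(2) by simp
  next
    case False
    then have "f \<in> set (flow_walk N g j F)"
      using flow_walks_meet[OF f(2) Fg j sf sg(1) v] by blast
    then show ?thesis using flow_sign_cancel[OF Fg f(2) j sg(1) sf v g(2) I] by simp
  qed
  finally show ?thesis .
next
  case False
  then show ?thesis by (intro sum.neutral) auto
qed

end

section \<open>Power series of walks and flows\<close>

lemma finite_submultisets: "finite {m'. m' \<subseteq># m}"
proof (rule finite_subset)
  show "{m'. m' \<subseteq># m} \<subseteq> mset ` {xs. set xs \<subseteq> set_mset m \<and> length xs \<le> size m}"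
  proof
    fix m' assume m': "m' \<in> {m'. m' \<subseteq># m}"
    obtain xs where "mset xs = m'" using ex_mset by blast
    then show "m' \<in> mset ` {xs. set xs \<subseteq> set_mset m \<and> length xs \<le> size m}"
      using m' set_mset_mono size_mset_mono by fastforce
  qed
qed (simp add: finite_lists_length_le)

text \<open>As the constant term of \<open>g\<close> is nonzero, the coefficient of a quotient at
  \<open>m\<close> is determined by those at proper submultisets of \<open>m\<close>.\<close>

lemma series_div_eqI:
  assumes mult: "series_mult q g = f" and g: "g {#} \<noteq> 0"
  shows "series_div f g = q"
  unfolding series_div_def
proof (rule the_equality)
  fix q' assume q': "series_mult q' g = f"
  have "q' m = q m" for m
  proof (induction m rule: measure_induct_rule[of size])
    case (less m)
    have split: "series_mult p g m = p m * g {#} + (\<Sum>m'\<in>{m'. m' \<subseteq># m} - {m}. p m' * g (m - m'))" for p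
      unfolding series_mult_def by (subst sum.remove[of _ m]) (auto simp: finite_submultisets)
    have "(\<Sum>m'\<in>{m'. m' \<subseteq># m} - {m}. q' m' * g (m - m')) = (\<Sum>m'\<in>{m'. m' \<subseteq># m} - {m}. q m' * g (m - m'))"
      using less mset_subset_size by (intro sum.cong refl) (auto simp: subset_mset.less_le)
    moreover have "series_mult q' g m = series_mult q g m" using q' mult by simp
    ultimately show "q' m = q m" using g unfolding split by simp
  qed
  then show "q' = q" by blast
qed (rule mult)

lemma mset_set_insert_set_mset:
  "mset_set (insert e (set_mset m)) = add_mset e m \<longleftrightarrow> e \<notin># m \<and> mset_set (set_mset m) = m"
proof (cases "e \<in># m")
  case True
  have "mset_set (insert e (set_mset m)) \<noteq> add_mset e m"
  proof
    assume eq: "mset_set (insert e (set_mset m)) = add_mset e m"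
    have "count (mset_set (insert e (set_mset m))) e \<le> 1" by (simp add: count_mset_set')
    then show False using True unfolding eq by (simp add: count_eq_zero_iff)
  qed
  then show ?thesis using True by blast
qed simp

text \<open>The condition \<open>mset_set (set_mset m) = m\<close> says that \<open>m\<close> is
  squarefree; each such monomial comes from exactly one finite set.\<close>

lemma formal_sum_sets:
  assumes "\<And>F. F \<in> X \<Longrightarrow> finite F"
  shows "formal_sum X c mset_set m
    = (if mset_set (set_mset m) = m \<and> set_mset m \<in> X then c (set_mset m) else 0)"
proof -
  have "{F \<in> X. mset_set F = m} = (if mset_set (set_mset m) = m \<and> set_mset m \<in> X then {set_mset m} else {})"
    using assms by auto
  then show ?thesis by (simp add: formal_sum_def)
qed

lemma has_sum_regroup:
  fixes f :: "'a \<Rightarrow> real"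
  assumes f: "(f has_sum s) A" and fin: "\<And>m. finite {x \<in> A. \<phi> x = m}"
  shows "((\<lambda>m. \<Sum>x | x \<in> A \<and> \<phi> x = m. f x) has_sum s) UNIV"
proof (rule has_sum_SigmaD)
  show "((\<lambda>(m, x). f x) has_sum s) (SIGMA m:UNIV. {x \<in> A. \<phi> x = m})"
    using f by (rule has_sum_reindex_bij_witness[of _ snd "\<lambda>x. (\<phi> x, x)", THEN iffD1, rotated -1]) auto
  show "((\<lambda>x. case (m, x) of (m, x) \<Rightarrow> f x) has_sum (\<Sum>x | x \<in> A \<and> \<phi> x = m. f x)) {x \<in> A. \<phi> x = m}" for m
    using fin by simp
qed

lemma has_sum_sum:
  fixes f :: "'b \<Rightarrow> 'a \<Rightarrow> real"
  assumes "finite X" "\<And>x. x \<in> X \<Longrightarrow> (f x has_sum s x) A"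
  shows "((\<lambda>y. \<Sum>x\<in>X. f x y) has_sum sum s X) A"
  using assms by (induction X) (simp_all add: has_sum_add)

context plabic_net
begin

section \<open>Recursions for the coefficients\<close>

lemma conservative_series_eq:
  "conservative_series N m
    = (if mset_set (set_mset m) = m \<and> set_mset m \<in> conservative_flows N then 1 else 0)"
  unfolding conservative_series_def by (rule formal_sum_sets) (rule conservative_flowsD(2))

lemma flow_series_eq:
  "flow_series N l e j m
    = (if mset_set (set_mset m) = m \<and> set_mset m \<in> edge_flows N e j
       then flow_sign N l e j (set_mset m) else 0)"
  unfolding flow_series_def by (rule formal_sum_sets) (rule edge_flowsD(2))

abbreviation step_sign :: "'e \<Rightarrow> 'e \<Rightarrow> real" where
  "step_sign e f \<equiv> (- 1) ^ arc_int N l e * (- 1) powi turn N l e f"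

text \<open>If \<open>m\<close> is not squarefree, everything vanishes. Otherwise \<open>m\<close>
  is a set \<open>H\<close>, and prepending \<open>e\<close> to flows with arc set \<open>H\<close>
  is a bijection as long as \<open>e\<close> is not in \<open>H\<close>.\<close>

lemma flow_series_rec:
  assumes j: "j \<in> sinks N" and e: "e \<in> arcs (graph N)"
  shows "flow_series N l e j (add_mset e m)
    = (if tgt e = bv N j then (- 1) ^ arc_int N l e * conservative_series N m else 0)
      + (\<Sum>f\<in>out_arcs (graph N) (tgt e). step_sign e f * flow_series N l f j m)"
proof (cases "mset_set (set_mset m) = m")
  case False
  then show ?thesis by (simp add: flow_series_eq conservative_series_eq mset_set_insert_set_mset)
next
  case simple: True
  define H where "H = set_mset m"
  have lhs: "flow_series N l e j (add_mset e m)
    = (if e \<notin> H \<and> insert e H \<in> edge_flows N e j then flow_sign N l e j (insert e H) else 0)"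
    using simple by (simp add: flow_series_eq mset_set_insert_set_mset H_def)
  have fs: "flow_series N l f j m = (if H \<in> edge_flows N f j then flow_sign N l f j H else 0)" for f
    using simple by (simp add: flow_series_eq H_def)
  have cs: "conservative_series N m = (if H \<in> conservative_flows N then 1 else 0)"
    using simple by (simp add: conservative_series_eq H_def)
  from e show ?thesis
  proof (cases rule: tgt_cases)
    case 2
    then have out: "out_arcs (graph N) (tgt e) = {}"
      using sink_out_arcs(1) tgt_boundary[OF e] by metis
    show ?thesis
    proof (cases "tgt e = bv N j")
      case True
      have "H \<in> conservative_flows N \<longleftrightarrow> e \<notin> H \<and> insert e H \<in> edge_flows N e j"
      proof
        assume "H \<in> conservative_flows N"
        then show "e \<notin> H \<and> insert e H \<in> edge_flows N e j"
          using edge_flow_insert_conservative[OF _ e True j] by blast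
      next
        assume "e \<notin> H \<and> insert e H \<in> edge_flows N e j"
        then show "H \<in> conservative_flows N"
          using edge_flow_minus_path[OF _ j, of "insert e H" e "[e]"] e True
          by (simp add: paths_Cons_iff[of "[e]"])
      qed
      then show ?thesis unfolding lhs cs out using True flow_sign_base[OF _ j True] by simp
    next
      case False
      then have "insert e H \<notin> edge_flows N e j"
        using edge_flow_tgt_boundary[OF _ j _ 2] by blast
      then show ?thesis unfolding lhs out using False by simp
    qed
  next
    case 1
    then have nj: "tgt e \<noteq> bv N j" using sink_boundary[OF j] internal_not_boundary by metis
    show ?thesis
    proof (cases "e \<in> H")
      case True
      \<comment> \<open>On the left, \<open>add_mset e m\<close> is no longer squarefree and gives
        0, so the right side has to cancel.\<close>
      have "(\<Sum>f\<in>out_arcs (graph N) (tgt e). step_sign e f * flow_series N l f j m)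
        = (- 1) ^ arc_int N l e * (\<Sum>f\<in>out_arcs (graph N) (tgt e).
            if H \<in> edge_flows N f j then (- 1) powi turn N l e f * flow_sign N l f j H else 0)"
        unfolding sum_distrib_left fs by (intro sum.cong) auto
      also have "\<dots> = 0"
      proof (cases "H \<subseteq> arcs (graph N)")
        case sub: True
        show ?thesis using flow_sign_sum_zero[OF sub True 1 j] by simp
      next
        case False
        then have "H \<notin> edge_flows N f j" for f using edge_flowsD(1) by blast
        then show ?thesis by simp
      qed
      finally show ?thesis unfolding lhs using True nj by simp
    next
      case eH: False
      show ?thesis
      proof (cases "insert e H \<in> edge_flows N e j")
        case True
        obtain f where f: "insert e H \<inter> out_arcs (graph N) (tgt e) = {f}"
          using edge_flow_next[OF True 1] by metis
        then have f': "f \<in> insert e H" "f \<in> out_arcs (graph N) (tgt e)" by auto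
        have Hf: "H \<in> edge_flows N f j"
          using edge_flow_remove[OF True j 1 f'(1)] f'(2) eH by simp
        \<comment> \<open>A flow contains its first arc, and \<open>H\<close> contains no arc out of
          this vertex except \<open>f\<close>.\<close>
        have "H \<notin> edge_flows N g j" if "g \<in> out_arcs (graph N) (tgt e)" "g \<noteq> f" for g
          using that f edge_flowsD(3)[of H g j] by blast
        then have "(\<Sum>g\<in>out_arcs (graph N) (tgt e). step_sign e g * flow_series N l g j m)
          = (\<Sum>g\<in>out_arcs (graph N) (tgt e). if g = f then step_sign e f * flow_sign N l f j H else 0)"
          unfolding fs using Hf by (intro sum.cong) auto
        also have "\<dots> = step_sign e f * flow_sign N l f j H"
          using f'(2) G.finite_out_arcs by (simp add: sum.delta)
        also have "\<dots> = flow_sign N l e j (insert e H)"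
          using flow_sign_step[OF True j 1 f'(1)] f'(2) eH by simp
        finally show ?thesis unfolding lhs using True nj eH by simp
      next
        case False
        then have "H \<notin> edge_flows N f j" if "f \<in> out_arcs (graph N) (tgt e)" for f
          using edge_flow_insert[OF _ e eH 1, of f] that by auto
        then have "(\<Sum>f\<in>out_arcs (graph N) (tgt e). step_sign e f * flow_series N l f j m) = 0"
          unfolding fs by (intro sum.neutral) auto
        then show ?thesis unfolding lhs using False nj by simp
      qed
    qed
  qed
qed

lemma finite_paths_mset: "finite {P \<in> paths N e j. mset P = m}"
proof -
  obtain xs where "mset xs = m" using ex_mset by blast
  then show ?thesis using mset_eq_finite[of xs] by (auto intro: finite_subset)
qed

lemma path_series_rec:
  assumes j: "j \<in> sinks N" and e: "e \<in> arcs (graph N)"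
  shows "path_series N l e j (add_mset e m)
    = (if tgt e = bv N j \<and> m = {#} then (- 1) ^ arc_int N l e else 0)
      + (\<Sum>f\<in>out_arcs (graph N) (tgt e). step_sign e f * path_series N l f j m)"
proof -
  define Z where "Z f = (#) e ` {Q \<in> paths N f j. mset Q = m}" for f
  define Y where "Y = (if tgt e = bv N j \<and> m = {#} then {[e]} else {})"
  have Z: "P \<in> Z f \<longleftrightarrow> (\<exists>Q. P = e # Q \<and> Q \<in> paths N f j \<and> mset Q = m)" for P f
    by (auto simp: Z_def)
  have finZ: "finite (Z f)" for f unfolding Z_def using finite_paths_mset by blast
  have "P \<in> paths N e j \<and> mset P = add_mset e m
      \<longleftrightarrow> P \<in> Y \<union> (\<Union>f\<in>out_arcs (graph N) (tgt e). Z f)" for P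
  proof -
    have "P \<in> paths N e j \<and> mset P = add_mset e m \<longleftrightarrow>
      (P = [e] \<and> tgt e = bv N j \<or> (\<exists>f Q. P = e # Q \<and> src f = tgt e \<and> Q \<in> paths N f j)) \<and> mset P = add_mset e m"
      using e by (subst paths_Cons_iff) simp
    also have "\<dots> \<longleftrightarrow> P \<in> Y \<union> (\<Union>f\<in>out_arcs (graph N) (tgt e). Z f)"
      by (auto simp: Y_def Z Bex_def intro: pathsD(5))
    finally show ?thesis .
  qed
  then have eq: "{P. P \<in> paths N e j \<and> mset P = add_mset e m}
      = Y \<union> (\<Union>f\<in>out_arcs (graph N) (tgt e). Z f)" by blast
  have ZQ: "\<exists>Q. P = e # Q \<and> Q \<noteq> [] \<and> hd Q = f" if "P \<in> Z f" for P f
    using that pathsD(1,2) by (auto simp: Z_def)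
  have "path_series N l e j (add_mset e m)
    = sum (path_sign N l) Y + (\<Sum>f\<in>out_arcs (graph N) (tgt e). sum (path_sign N l) (Z f))"
    unfolding path_series_def formal_sum_def eq
  proof (subst sum.union_disjoint)
    show "Y \<inter> (\<Union>f\<in>out_arcs (graph N) (tgt e). Z f) = {}"
      using ZQ by (auto simp: Y_def split: if_splits)
    have "\<forall>f\<in>out_arcs (graph N) (tgt e). \<forall>g\<in>out_arcs (graph N) (tgt e). f \<noteq> g \<longrightarrow> Z f \<inter> Z g = {}"
      using ZQ by (metis disjoint_iff list.inject)
    then show "sum (path_sign N l) Y + sum (path_sign N l) (\<Union>f\<in>out_arcs (graph N) (tgt e). Z f)
      = sum (path_sign N l) Y + (\<Sum>f\<in>out_arcs (graph N) (tgt e). sum (path_sign N l) (Z f))"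
      using finZ G.finite_out_arcs by (subst sum.UNION_disjoint) auto
  qed (use finZ in \<open>auto simp: Y_def G.finite_out_arcs\<close>)
  moreover have "sum (path_sign N l) (Z f) = step_sign e f * path_series N l f j m" for f
  proof -
    have "sum (path_sign N l) (Z f) = (\<Sum>Q | Q \<in> paths N f j \<and> mset Q = m. path_sign N l (e # Q))"
      unfolding Z_def by (subst sum.reindex) auto
    also have "\<dots> = (\<Sum>Q | Q \<in> paths N f j \<and> mset Q = m. step_sign e f * path_sign N l Q)"
      using pathsD(1,2) by (intro sum.cong refl) (auto simp: path_sign_Cons)
    finally show ?thesis by (simp add: path_series_def formal_sum_def sum_distrib_left)
  qed
  moreover have "sum (path_sign N l) Y
      = (if tgt e = bv N j \<and> m = {#} then (- 1) ^ arc_int N l e else 0)"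
    by (simp add: Y_def path_sign_singleton)
  ultimately show ?thesis by simp
qed

lemma path_series_no_arc:
  assumes "e \<notin># m"
  shows "path_series N l e j m = 0"
proof -
  have "{P. P \<in> paths N e j \<and> mset P = m} = {}"
    using assms pathsD(6) by fastforce
  then show ?thesis by (simp only: path_series_def formal_sum_def sum.empty)
qed

lemma flow_series_no_arc:
  assumes "e \<notin># m"
  shows "flow_series N l e j m = 0"
  using assms edge_flowsD(3) by (auto simp: flow_series_eq)

lemma mult_no_arc:
  assumes "e \<notin># m"
  shows "series_mult (path_series N l e j) g m = 0"
  unfolding series_mult_def
proof (rule sum.neutral, rule ballI)
  fix m' assume "m' \<in> {m'. m' \<subseteq># m}"
  then have "e \<notin># m'" using assms mset_subset_eqD by fastforce
  then show "path_series N l e j m' * g (m - m') = 0" by (simp add: path_series_no_arc)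
qed

text \<open>The one-arc walk has coefficient only at \<open>m = {#}\<close> in
  \<open>path_series_rec\<close>; multiplication by \<open>g\<close> spreads it to
  \<open>g m\<close>. For the conservative series this is exactly the shape of
  \<open>flow_series_rec\<close>.\<close>

lemma mult_rec:
  assumes j: "j \<in> sinks N" and e: "e \<in> arcs (graph N)"
  shows "series_mult (path_series N l e j) g (add_mset e m)
    = (if tgt e = bv N j then (- 1) ^ arc_int N l e * g m else 0)
      + (\<Sum>f\<in>out_arcs (graph N) (tgt e). step_sign e f * series_mult (path_series N l f j) g m)"
proof -
  let ?A = "{m'. m' \<subseteq># m}" and ?O = "out_arcs (graph N) (tgt e)"
  let ?c = "(- 1) ^ arc_int N l e :: real"
  have "series_mult (path_series N l e j) g (add_mset e m)
    = (\<Sum>m'\<in>add_mset e ` ?A. path_series N l e j m' * g (add_mset e m - m'))"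
    unfolding series_mult_def
  proof (rule sum.mono_neutral_right)
    show "\<forall>m'\<in>{m'. m' \<subseteq># add_mset e m} - add_mset e ` ?A. path_series N l e j m' * g (add_mset e m - m') = 0"
    proof
      fix m' assume m': "m' \<in> {m'. m' \<subseteq># add_mset e m} - add_mset e ` ?A"
      have "e \<notin># m'"
      proof
        assume "e \<in># m'"
        then obtain m'' where "m' = add_mset e m''" by (metis insert_DiffM)
        with m' show False by auto
      qed
      then show "path_series N l e j m' * g (add_mset e m - m') = 0" by (simp add: path_series_no_arc)
    qed
  qed (auto simp: finite_submultisets)
  also have "\<dots> = (\<Sum>m'\<in>?A. path_series N l e j (add_mset e m') * g (m - m'))"
    by (subst sum.reindex) (auto simp: inj_on_def)
  also have "\<dots> = (\<Sum>m'\<in>?A. (if m' = {#} then (if tgt e = bv N j then ?c * g m else 0) else 0)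
      + (\<Sum>f\<in>?O. step_sign e f * (path_series N l f j m' * g (m - m'))))"
    by (intro sum.cong refl) (auto simp: path_series_rec[OF j e] distrib_right sum_distrib_right mult.assoc)
  also have "\<dots> = (if tgt e = bv N j then ?c * g m else 0)
      + (\<Sum>m'\<in>?A. \<Sum>f\<in>?O. step_sign e f * (path_series N l f j m' * g (m - m')))"
    by (simp add: sum.distrib finite_submultisets sum.delta)
  also have "(\<Sum>m'\<in>?A. \<Sum>f\<in>?O. step_sign e f * (path_series N l f j m' * g (m - m')))
      = (\<Sum>f\<in>?O. step_sign e f * series_mult (path_series N l f j) g m)"
    unfolding series_mult_def sum_distrib_left by (rule sum.swap)
  finally show ?thesis .
qed

text \<open>Both sides vanish at monomials without \<open>e\<close> and otherwise obey the same
  recursion in smaller monomials; the induction runs over all arcs simultaneously.\<close>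

theorem path_series_mult_conservative:
  assumes j: "j \<in> sinks N"
  shows "e \<in> arcs (graph N) \<Longrightarrow>
    series_mult (path_series N l e j) (conservative_series N) m = flow_series N l e j m"
proof (induction "size m" arbitrary: m e rule: less_induct)
  case less
  show ?case
  proof (cases "e \<in># m")
    case True
    then obtain m' where m': "m = add_mset e m'" by (metis insert_DiffM)
    have "series_mult (path_series N l f j) (conservative_series N) m' = flow_series N l f j m'"
      if "f \<in> out_arcs (graph N) (tgt e)" for f
      using less.hyps[of m' f] that m' by simp
    then show ?thesis
      unfolding m' mult_rec[OF j less.prems] flow_series_rec[OF j less.prems] by simp
  next
    case False
    then show ?thesis by (simp add: mult_no_arc flow_series_no_arc)
  qed
qed

lemma empty_conservative: "{} \<in> conservative_flows N"
  by (simp add: conservative_flows_def balanced_def)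

lemma finite_conservative_flows: "finite (conservative_flows N)"
  by (rule finite_subset[of _ "Pow (arcs (graph N))"]) (use conservative_flowsD(1) in blast, simp)

lemma finite_edge_flows: "finite (edge_flows N e j)"
  by (rule finite_subset[of _ "Pow (arcs (graph N))"]) (use edge_flowsD(1) in blast, simp)

lemma series_div_flow_series:
  assumes "j \<in> sinks N" "e \<in> arcs (graph N)"
  shows "series_div (flow_series N l e j) (conservative_series N) = path_series N l e j"
proof (rule series_div_eqI)
  show "series_mult (path_series N l e j) (conservative_series N) = flow_series N l e j"
    using path_series_mult_conservative[OF assms] by blast
  show "conservative_series N {#} \<noteq> 0"
    using empty_conservative by (simp add: conservative_series_eq)
qed

section \<open>Evaluation at real weights\<close>

lemma mult_conservative_series:
  "series_mult p (conservative_series N) m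
    = (\<Sum>C\<in>conservative_flows N. if mset_set C \<subseteq># m then p (m - mset_set C) else 0)"
proof -
  let ?A = "{m'. m' \<subseteq># m}" and ?S = "{C \<in> conservative_flows N. mset_set C \<subseteq># m}"
  have dd: "m - (m - m') = m'" if "m' \<subseteq># m" for m'
    using that by (simp add: multiset_eq_iff subseteq_mset_def)
  have "series_mult p (conservative_series N) m = (\<Sum>m'\<in>?A. p (m - m') * conservative_series N m')"
    unfolding series_mult_def
    by (rule sum.reindex_bij_witness[of _ "\<lambda>m'. m - m'" "\<lambda>m'. m - m'"])
      (auto simp: dd diff_subset_eq_self)
  also have "\<dots> = (\<Sum>m'\<in>?A. \<Sum>C | C \<in> ?S \<and> mset_set C = m'. p (m - mset_set C))"
  proof (intro sum.cong refl)
    fix m' assume "m' \<in> ?A"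
    then have "{C. C \<in> ?S \<and> mset_set C = m'} = {C. C \<in> conservative_flows N \<and> mset_set C = m'}"
      by auto
    then show "p (m - m') * conservative_series N m' = (\<Sum>C | C \<in> ?S \<and> mset_set C = m'. p (m - mset_set C))"
      by (simp add: conservative_series_def formal_sum_def)
  qed
  also have "\<dots> = (\<Sum>C\<in>?S. p (m - mset_set C))"
    by (rule sum.group) (auto simp: finite_conservative_flows finite_submultisets)
  also have "\<dots> = (\<Sum>C\<in>conservative_flows N. if mset_set C \<subseteq># m then p (m - mset_set C) else 0)"
    by (rule sum.inter_filter[OF finite_conservative_flows])
  finally show ?thesis .
qed

text \<open>The walk sum times each conservative flow weight is regrouped by monomials, whose fibres
  are finite. Adding over the finitely many conservative flows gives the coefficients of the formal
  product, hence the flow polynomial. Summability matters since \<open>infsum\<close> is 0 for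
  families that are not summable.\<close>

theorem path_sum_eq_flow_quotient:
  fixes w :: "'e \<Rightarrow> real"
  assumes j: "j \<in> sinks N" and e: "e \<in> arcs (graph N)"
    and pos: "0 < (\<Sum>C\<in>conservative_flows N. \<Prod>a\<in>C. w a)"
    and summable: "(\<lambda>P. path_sign N l P * (\<Prod>a\<leftarrow>P. w a)) summable_on paths N e j"
  shows "(\<Sum>\<^sub>\<infinity>P\<in>paths N e j. path_sign N l P * (\<Prod>a\<leftarrow>P. w a))
    = (\<Sum>F\<in>edge_flows N e j. flow_sign N l e j F * (\<Prod>a\<in>F. w a))
      / (\<Sum>C\<in>conservative_flows N. \<Prod>a\<in>C. w a)"
proof -
  let ?f = "\<lambda>P. path_sign N l P * (\<Prod>a\<leftarrow>P. w a)"
  let ?W = "\<lambda>C. \<Prod>a\<in>C. w a"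
  define mon where "mon m = (\<Prod>a\<in>#m. w a)" for m
  have mon_list: "(\<Prod>a\<leftarrow>P. w a) = mon (mset P)" for P
    by (simp add: mon_def flip: prod_mset_prod_list)
  have mon_set: "?W C = mon (mset_set C)" for C
    by (simp add: mon_def prod_unfold_prod_mset)
  have mon_add: "mon (m + m') = mon m * mon m'" for m m' by (simp add: mon_def)
  define s where "s = infsum ?f (paths N e j)"
  have s: "(?f has_sum s) (paths N e j)" unfolding s_def using summable by simp
  have part: "((\<lambda>m. mon m * (if mset_set C \<subseteq># m then path_series N l e j (m - mset_set C) else 0))
      has_sum (s * ?W C)) UNIV" for C
  proof -
    let ?fib = "\<lambda>m. {P. P \<in> paths N e j \<and> mset P + mset_set C = m}"
    have fib: "?fib m = (if mset_set C \<subseteq># m then {P. P \<in> paths N e j \<and> mset P = m - mset_set C} else {})" for m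
      by auto
    have fin: "finite (?fib m)" for m unfolding fib using finite_paths_mset by simp
    have "((\<lambda>m. \<Sum>P\<in>?fib m. ?f P * ?W C) has_sum (s * ?W C)) UNIV"
      by (rule has_sum_regroup[OF has_sum_cmult_left[OF s] fin])
    moreover have "(\<Sum>P\<in>?fib m. ?f P * ?W C)
      = mon m * (if mset_set C \<subseteq># m then path_series N l e j (m - mset_set C) else 0)" for m
    proof -
      have "(\<Sum>P\<in>?fib m. ?f P * ?W C) = (\<Sum>P\<in>?fib m. mon m * path_sign N l P)"
        by (intro sum.cong refl) (auto simp: mon_list mon_set mon_add)
      also have "\<dots> = mon m * (\<Sum>P\<in>?fib m. path_sign N l P)" by (simp add: sum_distrib_left)
      also have "(\<Sum>P\<in>?fib m. path_sign N l P)
        = (if mset_set C \<subseteq># m then path_series N l e j (m - mset_set C) else 0)"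
        unfolding fib by (simp add: path_series_def formal_sum_def)
      finally show ?thesis .
    qed
    ultimately show ?thesis by simp
  qed
  have "((\<lambda>m. \<Sum>C\<in>conservative_flows N.
      mon m * (if mset_set C \<subseteq># m then path_series N l e j (m - mset_set C) else 0))
    has_sum (\<Sum>C\<in>conservative_flows N. s * ?W C)) UNIV"
    using finite_conservative_flows part by (intro has_sum_sum)
  then have "((\<lambda>m. mon m * flow_series N l e j m) has_sum (\<Sum>C\<in>conservative_flows N. s * ?W C)) UNIV"
    by (simp add: mult_conservative_series path_series_mult_conservative[OF j e, symmetric] sum_distrib_left)
  moreover have "((\<lambda>m. mon m * flow_series N l e j m)
    has_sum (\<Sum>F\<in>edge_flows N e j. flow_sign N l e j F * ?W F)) UNIV"
  proof -
    let ?g = "\<lambda>F. flow_sign N l e j F * ?W F"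
    have "((\<lambda>m. \<Sum>F | F \<in> edge_flows N e j \<and> mset_set F = m. ?g F) has_sum sum ?g (edge_flows N e j)) UNIV"
      by (rule has_sum_regroup) (simp_all add: finite_edge_flows)
    moreover have "(\<Sum>F | F \<in> edge_flows N e j \<and> mset_set F = m. ?g F) = mon m * flow_series N l e j m" for m
      unfolding flow_series_def formal_sum_def sum_distrib_left
      by (intro sum.cong refl) (auto simp: mon_set)
    ultimately show ?thesis by simp
  qed
  ultimately have "(\<Sum>C\<in>conservative_flows N. s * ?W C) = (\<Sum>F\<in>edge_flows N e j. flow_sign N l e j F * ?W F)"
    by (rule has_sum_unique)
  then have "s * (\<Sum>C\<in>conservative_flows N. ?W C) = (\<Sum>F\<in>edge_flows N e j. flow_sign N l e j F * ?W F)"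
    by (simp add: sum_distrib_left)
  then show ?thesis using pos unfolding s_def by (simp add: eq_divide_eq)
qed

lemma conservative_sum_pos:
  assumes "positive_weights N w"
  shows "0 < (\<Sum>C\<in>conservative_flows N. \<Prod>a\<in>C. w a)"
  using finite_conservative_flows empty_conservative conservative_flowsD(1) assms
  by (intro sum_pos) (auto intro!: prod_pos simp: positive_weights_def subset_iff)

end

text \<open>The identity is given for formal series and again as real numbers wherever the walk sums
  converge. Nonnegative coefficients express that the denominator is subtraction-free; its
  positivity makes the quotient meaningful for all positive weights.\<close>

theorem theorem3p12:
  fixes N :: "'e plabic" and w :: "'e \<Rightarrow> real" and l :: complex
    and I :: "nat set" and k n :: nat and A :: "real mat"
    and B :: "nat \<Rightarrow> 'v::real_vector" and e :: 'e
  assumes "plabic_graph N" and "positive_weights N w"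
    and "n = nb N" and "I = sources N" and "k = card I" and "I \<in> matroid N"
    and "A \<in> tnn_cell k n (matroid N)" and "represents N w A"
    and "gauge_direction N l"
    and "e \<in> arcs (graph N)"
  shows "edge_vector N l B e
           = vector_series (sinks N)
               (\<lambda>j. series_div (flow_series N l e j) (conservative_series N)) B
         \<and> (\<forall>m. 0 \<le> conservative_series N m)
         \<and> 0 < (\<Sum>C\<in>conservative_flows N. \<Prod>a\<in>C. w a)
         \<and> ((\<forall>j\<in>sinks N. (\<lambda>P. path_sign N l P * (\<Prod>a\<leftarrow>P. w a)) summable_on paths N e j) \<longrightarrow>
           (\<Sum>j\<in>sinks N. (\<Sum>\<^sub>\<infinity>P\<in>paths N e j. path_sign N l P * (\<Prod>a\<leftarrow>P. w a)) *\<^sub>R B j)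
           = (\<Sum>j\<in>sinks N. ((\<Sum>F\<in>edge_flows N e j. flow_sign N l e j F * (\<Prod>a\<in>F. w a))
                / (\<Sum>C\<in>conservative_flows N. \<Prod>a\<in>C. w a)) *\<^sub>R B j))"
proof -
  interpret plabic_net N l
    using assms(1,9) by unfold_locales
  have pos: "0 < (\<Sum>C\<in>conservative_flows N. \<Prod>a\<in>C. w a)"
    using assms(2) by (rule conservative_sum_pos)
  have series: "edge_vector N l B e
      = vector_series (sinks N) (\<lambda>j. series_div (flow_series N l e j) (conservative_series N)) B"
    unfolding edge_vector_def vector_series_def
    using assms(10) by (intro ext sum.cong refl) (simp add: series_div_flow_series)
  have nonneg: "0 \<le> conservative_series N m" for m
    by (simp add: conservative_series_eq)
  show ?thesis
    using series nonneg pos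
    by (auto intro!: sum.cong simp: path_sum_eq_flow_quotient[OF _ assms(10) pos])
qed

end
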